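(* Let $S_1$ be the backward shift on $L^2(0,\infty)$ given by $(S_1 f)(t) = f(t+1)$ for almost every $t \ge 0$, and let $(U_t)_{t \ge 0}$ be the $C_0$-semigroup on $L^2(0,\infty)$ whose cogenerator is $S_1$. Then for every quasicontractive $C_0$-semigroup $(T(t))_{t \ge 0}$ on a separable infinite-dimensional Hilbert space $\mathcal{K}$ there are a closed subspace $\mathcal{M}$ of $L^2(0,\infty)$ invariant for every $U_t$, $t \ge 0$, a constant $\lambda \in \mathbb{R}$, and a bounded linear isomorphism $R : \mathcal{M} \to \mathcal{K}$ such that $$T(t) = e^{\lambda t} R\, (U_t)_{|\mathcal{M}}\, R^{-1} \quad \text{for all } t \ge 0.$$
   Context: All Hilbert spaces are complex. A $C_0$-semigroup is a strongly continuous one-parameter semigroup $(T_t)_{t\ge0}$ of bounded operators, with generator $A$. If $1$ is not in the spectrum of $A$, the cogenerator of the semigroup is the bounded operator $V = (A+\mathrm{Id})(A-\mathrm{Id})^{-1}$. A bounded operator $V$ is the cogenerator of a $C_0$-semigroup of contractions if and only if $V$ is a contraction and $1$ is not an eigenvalue of $V$. A semigroup $(T(t))_{t\ge 0}$ is quasicontractive if there is $\omega \in \mathbb{R}$ such that $\|T(t)\| \le e^{\omega t}$ for all $t \ge 0$. *)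

theory Defs
  imports "HOL-Analysis.Analysis"
begin

section \<open>Complex Hilbert spaces\<close>

text \<open>
  A complex inner product space is presented as a real inner product space carrying a
  multiplication by complex scalars that extends the real one and a sesquilinear form (linear in
  the first argument) whose real part is the real inner product.  Norm, metric and topology are thus
  those of \<^class>\<open>real_inner\<close>, with \<open>norm x = sqrt (cinner x x)\<close>.
\<close>

class complex_inner = real_inner +
  fixes scaleC :: "complex \<Rightarrow> 'a \<Rightarrow> 'a"  (infixr "*\<^sub>C" 75)
    and cinner :: "'a \<Rightarrow> 'a \<Rightarrow> complex"
  assumes scaleC_add_right: "c *\<^sub>C (x + y) = c *\<^sub>C x + c *\<^sub>C y"
    and scaleC_add_left: "(c + d) *\<^sub>C x = c *\<^sub>C x + d *\<^sub>C x"
    and scaleC_scaleC: "c *\<^sub>C d *\<^sub>C x = (c * d) *\<^sub>C x"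
    and scaleR_eq_scaleC: "r *\<^sub>R x = complex_of_real r *\<^sub>C x"
    and cinner_commute: "cinner x y = cnj (cinner y x)"
    and cinner_add_left: "cinner (x + y) z = cinner x z + cinner y z"
    and cinner_scaleC_left: "cinner (c *\<^sub>C x) y = c * cinner x y"
    and inner_eq_Re_cinner: "inner x y = Re (cinner x y)"

class chilbert_space = complex_inner + complete_space

global_interpretation complex_vector:
  vector_space "scaleC :: complex \<Rightarrow> 'a \<Rightarrow> 'a::complex_inner"
  defines csubspace = complex_vector.subspace
    and cspan = complex_vector.span
proof
  fix x :: 'a
  show "1 *\<^sub>C x = x"
    using scaleR_eq_scaleC [of 1 x] by simp
qed (simp_all add: scaleC_add_right scaleC_add_left scaleC_scaleC)

lemma cinner_self: "cinner x x = complex_of_real ((norm x)\<^sup>2)"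
  using cinner_commute [of x x] inner_eq_Re_cinner [of x x]
  by (simp add: complex_eq_iff power2_norm_eq_inner)

definition bounded_clinear :: "('a::complex_inner \<Rightarrow> 'b::complex_inner) \<Rightarrow> bool" where
  "bounded_clinear f \<longleftrightarrow>
     Vector_Spaces.linear scaleC scaleC f \<and> (\<exists>K. \<forall>x. norm (f x) \<le> norm x * K)"

text \<open>
  A bounded linear isomorphism, with bounded inverse, of the subspace \<open>M\<close> onto the whole target
  space; the values of \<open>R\<close> outside \<open>M\<close> are irrelevant.
\<close>

definition bounded_clinear_iso_on ::
    "'a::complex_inner set \<Rightarrow> ('a \<Rightarrow> 'b::complex_inner) \<Rightarrow> bool" where
  "bounded_clinear_iso_on M R \<longleftrightarrow>
     (\<forall>x\<in>M. \<forall>y\<in>M. R (x + y) = R x + R y) \<and>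
     (\<forall>c. \<forall>x\<in>M. R (c *\<^sub>C x) = c *\<^sub>C R x) \<and>
     bij_betw R M UNIV \<and>
     (\<exists>K. \<forall>x\<in>M. norm (R x) \<le> norm x * K) \<and>
     (\<exists>K. \<forall>y. norm (inv_into M R y) \<le> norm y * K)"


section \<open>Semigroups, generators and cogenerators\<close>

text \<open>
  Semigroups are indexed by \<^typ>\<open>real\<close>; nothing is said about negative times.
\<close>

definition C0_semigroup :: "(real \<Rightarrow> 'a::complex_inner \<Rightarrow> 'a) \<Rightarrow> bool" where
  "C0_semigroup T \<longleftrightarrow>
     (\<forall>t\<ge>0. bounded_clinear (T t)) \<and>
     T 0 = id \<and>
     (\<forall>s\<ge>0. \<forall>t\<ge>0. T (s + t) = T s \<circ> T t) \<and>
     (\<forall>x. continuous_on {0..} (\<lambda>t. T t x))"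

definition quasicontractive :: "(real \<Rightarrow> 'a::complex_inner \<Rightarrow> 'a) \<Rightarrow> bool" where
  "quasicontractive T \<longleftrightarrow> (\<exists>\<omega>. \<forall>t\<ge>0. onorm (T t) \<le> exp (\<omega> * t))"

definition generator_domain :: "(real \<Rightarrow> 'a::complex_inner \<Rightarrow> 'a) \<Rightarrow> 'a set" where
  "generator_domain T = {x. \<exists>y. ((\<lambda>h. (T h x - x) /\<^sub>R h) \<longlongrightarrow> y) (at_right 0)}"

definition generator :: "(real \<Rightarrow> 'a::complex_inner \<Rightarrow> 'a) \<Rightarrow> 'a \<Rightarrow> 'a" where
  "generator T x = Lim (at_right 0) (\<lambda>h. (T h x - x) /\<^sub>R h)"

text \<open>Spectrum of an unbounded operator \<open>A\<close> with domain \<open>D\<close>.\<close>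

definition spectrum :: "'a::complex_inner set \<Rightarrow> ('a \<Rightarrow> 'a) \<Rightarrow> complex set" where
  "spectrum D A =
     {z. \<not> (bij_betw (\<lambda>x. A x - z *\<^sub>C x) D UNIV \<and>
            bounded_clinear (inv_into D (\<lambda>x. A x - z *\<^sub>C x)))}"

text \<open>\<open>V\<close> is the cogenerator of \<open>T\<close>: with \<open>A\<close> the generator of \<open>T\<close>, the number 1 is not in the
  spectrum of \<open>A\<close> and \<open>V = (A + Id) (A - Id)\<inverse>\<close>.\<close>

definition is_cogenerator ::
    "(real \<Rightarrow> 'a::complex_inner \<Rightarrow> 'a) \<Rightarrow> ('a \<Rightarrow> 'a) \<Rightarrow> bool" where
  "is_cogenerator T V \<longleftrightarrow>
     1 \<notin> spectrum (generator_domain T) (generator T) \<and>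
     V = (\<lambda>x. generator T x + x) \<circ> inv_into (generator_domain T) (\<lambda>x. generator T x - x)"


section \<open>The space \<open>L\<^sup>2(0,\<infinity>)\<close>\<close>

abbreviation half_line :: "real measure" where
  "half_line \<equiv> lebesgue_on {0<..}"

definition square_integrable :: "(real \<Rightarrow> complex) \<Rightarrow> bool" where
  "square_integrable f \<longleftrightarrow>
     f \<in> borel_measurable half_line \<and> integrable half_line (\<lambda>t. (cmod (f t))\<^sup>2)"

lemma square_integrable_add:
  assumes "square_integrable f" "square_integrable g"
  shows "square_integrable (\<lambda>t. f t + g t)"
proof -
  have [measurable]: "f \<in> borel_measurable half_line" "g \<in> borel_measurable half_line"
    using assms by (auto simp: square_integrable_def)
  have int: "integrable half_line (\<lambda>t. 2 * (cmod (f t))\<^sup>2 + 2 * (cmod (g t))\<^sup>2)"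
    using assms by (auto simp: square_integrable_def)
  have "(cmod (a + b))\<^sup>2 \<le> 2 * (cmod a)\<^sup>2 + 2 * (cmod b)\<^sup>2" for a b
  proof -
    have "(cmod (a + b))\<^sup>2 \<le> (cmod a + cmod b)\<^sup>2"
      by (simp add: norm_triangle_ineq power_mono)
    also have "\<dots> \<le> 2 * (cmod a)\<^sup>2 + 2 * (cmod b)\<^sup>2"
      using sum_squares_bound [of "cmod a" "cmod b"] by (simp add: power2_sum)
    finally show ?thesis .
  qed
  then have "integrable half_line (\<lambda>t. (cmod (f t + g t))\<^sup>2)"
    by (intro Bochner_Integration.integrable_bound [OF int]) auto
  then show ?thesis
    by (simp add: square_integrable_def)
qed

lemma square_integrable_mult:
  assumes "square_integrable f"
  shows "square_integrable (\<lambda>t. c * f t)"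
  using assms by (auto simp: square_integrable_def norm_mult power_mult_distrib)

lemma square_integrable_uminus:
  "square_integrable f \<Longrightarrow> square_integrable (\<lambda>t. - f t)"
  using square_integrable_mult [of f "-1"] by simp

lemma square_integrable_diff:
  "square_integrable f \<Longrightarrow> square_integrable g \<Longrightarrow> square_integrable (\<lambda>t. f t - g t)"
  using square_integrable_add [OF _ square_integrable_uminus, of f g] by simp

lemma square_integrable_0: "square_integrable (\<lambda>t. 0)"
  by (simp add: square_integrable_def)

lemma integrable_mult_cnj:
  assumes "square_integrable f" "square_integrable g"
  shows "integrable half_line (\<lambda>t. f t * cnj (g t))"
proof -
  have [measurable]: "f \<in> borel_measurable half_line" "g \<in> borel_measurable half_line"
    using assms by (auto simp: square_integrable_def)
  have [measurable]: "(\<lambda>t. cnj (g t)) \<in> borel_measurable half_line"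
    by (rule borel_measurable_continuous_on [OF _ \<open>g \<in> borel_measurable half_line\<close>])
      (intro continuous_intros)
  have "integrable half_line (\<lambda>t. (cmod (f t))\<^sup>2 + (cmod (g t))\<^sup>2)"
    using assms by (auto simp: square_integrable_def)
  then show ?thesis
  proof (rule Bochner_Integration.integrable_bound)
    have "cmod a * cmod b \<le> (cmod a)\<^sup>2 + (cmod b)\<^sup>2" for a b
      using sum_squares_bound [of "cmod a" "cmod b"] mult_nonneg_nonneg [of "cmod a" "cmod b"]
      by (simp del: mult_nonneg_nonneg)
    then show "AE t in half_line.
        norm (f t * cnj (g t)) \<le> norm ((cmod (f t))\<^sup>2 + (cmod (g t))\<^sup>2)"
      by (simp add: norm_mult)
  qed measurable
qed

lemma Re_integral_mult_cnj:
  "Re (\<integral>t. f t * cnj (f t) \<partial>half_line) = (\<integral>t. (cmod (f t))\<^sup>2 \<partial>half_line)"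
  by (simp only: complex_norm_square [symmetric] integral_complex_of_real Re_complex_of_real)

lemma square_integrable_shift:
  assumes "square_integrable f"
  shows "square_integrable (\<lambda>t. f (t + 1))"
proof -
  have sub: "{0<..} \<inter> space lebesgue \<in> sets (lebesgue :: real measure)"
    by simp
  have meas: "(\<lambda>t. indicator {0<..} t *\<^sub>R f t) \<in> borel_measurable lebesgue"
    using assms borel_measurable_restrict_space_iff [OF sub, of f]
    by (simp add: square_integrable_def)
  have aff: "(\<lambda>t. t + 1) \<in> lebesgue \<rightarrow>\<^sub>M (lebesgue :: real measure)"
    using lebesgue_affine_measurable [of "\<lambda>_. 1" "1 :: real"] by (simp add: add.commute)
  have "(\<lambda>t. indicator {0<..} (t + 1) *\<^sub>R f (t + 1)) \<in> borel_measurable lebesgue"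
    using measurable_compose [OF aff meas] .
  then have "(\<lambda>t. indicator {0<..} t *\<^sub>R (indicator {0<..} (t + 1) *\<^sub>R f (t + 1)))
      \<in> borel_measurable lebesgue"
    by (rule borel_measurable_scaleR [OF borel_measurable_indicator, rotated]) simp
  then have "(\<lambda>t. indicator {0<..} t *\<^sub>R f (t + 1)) \<in> borel_measurable lebesgue"
    by (rule back_subst [where P = "\<lambda>h. h \<in> borel_measurable lebesgue"])
      (auto simp: indicator_def fun_eq_iff)
  then have 1: "(\<lambda>t. f (t + 1)) \<in> borel_measurable half_line"
    using borel_measurable_restrict_space_iff [OF sub, of "\<lambda>t. f (t + 1)"] by simp
  have "integrable lebesgue (\<lambda>t. indicator {0<..} t *\<^sub>R (cmod (f t))\<^sup>2)"
    using assms by (simp add: square_integrable_def integrable_restrict_space)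
  then have "integrable lebesgue (\<lambda>t. indicator {0<..} (1 + 1 * t) *\<^sub>R (cmod (f (1 + 1 * t)))\<^sup>2)"
    using has_bochner_integral_lebesgue_real_affine_iff
      [of 1 "\<lambda>t. indicator {0<..} t *\<^sub>R (cmod (f t))\<^sup>2" _ 1]
    by (auto simp: has_bochner_integral_iff)
  then have "integrable lebesgue
      (\<lambda>t. indicator {0<..} t *\<^sub>R (indicator {0<..} (1 + 1 * t) *\<^sub>R (cmod (f (1 + 1 * t)))\<^sup>2))"
    by (rule integrable_mult_indicator [rotated]) simp
  then have "integrable lebesgue (\<lambda>t. indicator {0<..} t *\<^sub>R (cmod (f (t + 1)))\<^sup>2)"
    by (rule back_subst [where P = "integrable lebesgue"])
      (auto simp: indicator_def fun_eq_iff add.commute)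
  then have 2: "integrable half_line (\<lambda>t. (cmod (f (t + 1)))\<^sup>2)"
    by (simp add: integrable_restrict_space)
  from 1 2 show ?thesis
    by (simp add: square_integrable_def)
qed

lemma AE_half_line_shift:
  assumes "AE t in half_line. P t"
  shows "AE t in half_line. P (t + 1)"
proof -
  have "AE t in lebesgue. 0 < t \<longrightarrow> P t"
    using assms by (simp add: AE_restrict_space_iff)
  moreover have "lebesgue = distr lebesgue lebesgue (\<lambda>t::real. 1 + t)"
    using lebesgue_real_affine [of 1 1] by (simp add: density_1)
  ultimately have "AE t in distr lebesgue lebesgue (\<lambda>t::real. 1 + t). 0 < t \<longrightarrow> P t"
    by metis
  then have "AE t in lebesgue. 0 < 1 + t \<longrightarrow> P (1 + t)"
    by (rule AE_distrD [rotated])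
      (use lebesgue_affine_measurable [of "\<lambda>_. 1" "1 :: real"] in simp)
  then show ?thesis
    by (auto simp: AE_restrict_space_iff add.commute elim!: eventually_mono)
qed

definition L2_eq :: "(real \<Rightarrow> complex) \<Rightarrow> (real \<Rightarrow> complex) \<Rightarrow> bool" where
  "L2_eq f g \<longleftrightarrow>
     square_integrable f \<and> square_integrable g \<and> (AE t in half_line. f t = g t)"

quotient_type L2_half_line = "real \<Rightarrow> complex" / partial: L2_eq
proof (rule part_equivpI)
  show "\<exists>f. L2_eq f f"
    using square_integrable_0 by (auto simp: L2_eq_def)
  show "symp L2_eq"
    by (auto simp: symp_def L2_eq_def elim!: eventually_mono)
  show "transp L2_eq"
    by (auto simp: transp_def L2_eq_def)
qed

instantiation L2_half_line :: real_inner
begin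

lift_definition zero_L2_half_line :: L2_half_line is "\<lambda>t. 0"
  by (simp add: L2_eq_def square_integrable_0)

lift_definition plus_L2_half_line :: "L2_half_line \<Rightarrow> L2_half_line \<Rightarrow> L2_half_line"
  is "\<lambda>f g t. f t + g t"
  by (auto simp: L2_eq_def square_integrable_add)

lift_definition uminus_L2_half_line :: "L2_half_line \<Rightarrow> L2_half_line" is "\<lambda>f t. - f t"
  by (auto simp: L2_eq_def square_integrable_uminus)

lift_definition minus_L2_half_line :: "L2_half_line \<Rightarrow> L2_half_line \<Rightarrow> L2_half_line"
  is "\<lambda>f g t. f t - g t"
  by (auto simp: L2_eq_def square_integrable_diff)

lift_definition scaleR_L2_half_line :: "real \<Rightarrow> L2_half_line \<Rightarrow> L2_half_line"
  is "\<lambda>r f t. complex_of_real r * f t"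
  by (auto simp: L2_eq_def square_integrable_mult)

lift_definition inner_L2_half_line :: "L2_half_line \<Rightarrow> L2_half_line \<Rightarrow> real"
  is "\<lambda>f g. Re (\<integral>t. f t * cnj (g t) \<partial>half_line)"
proof -
  fix f f' g g' assume *: "L2_eq f f'" "L2_eq g g'"
  then have "(\<integral>t. f t * cnj (g t) \<partial>half_line) = (\<integral>t. f' t * cnj (g' t) \<partial>half_line)"
    by (intro integral_cong_AE borel_measurable_integrable integrable_mult_cnj)
      (auto simp: L2_eq_def)
  then show "Re (\<integral>t. f t * cnj (g t) \<partial>half_line) = Re (\<integral>t. f' t * cnj (g' t) \<partial>half_line)"
    by simp
qed

definition norm_L2_half_line :: "L2_half_line \<Rightarrow> real" where
  "norm_L2_half_line x = sqrt (inner x x)"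

definition dist_L2_half_line :: "L2_half_line \<Rightarrow> L2_half_line \<Rightarrow> real" where
  "dist_L2_half_line x y = norm (x - y)"

definition sgn_L2_half_line :: "L2_half_line \<Rightarrow> L2_half_line" where
  "sgn_L2_half_line x = inverse (norm x) *\<^sub>R x"

definition uniformity_L2_half_line :: "(L2_half_line \<times> L2_half_line) filter" where
  "uniformity_L2_half_line = (INF e\<in>{0<..}. principal {(x, y). dist x y < e})"

definition open_L2_half_line :: "L2_half_line set \<Rightarrow> bool" where
  "open_L2_half_line S = (\<forall>x\<in>S. \<forall>\<^sub>F (x', y) in uniformity. x' = x \<longrightarrow> y \<in> S)"

instance
proof
  fix x y z :: L2_half_line and r s :: real and S :: "L2_half_line set"
  show "x + y + z = x + (y + z)" "x + y = y + x"
    by (transfer; auto simp: L2_eq_def algebra_simps square_integrable_add)+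
  show "0 + x = x" "- x + x = 0" "x - y = x + - y"
    by (transfer; auto simp: L2_eq_def square_integrable_add square_integrable_diff
          square_integrable_uminus square_integrable_0)+
  show "r *\<^sub>R (x + y) = r *\<^sub>R x + r *\<^sub>R y"
    by transfer (simp add: L2_eq_def distrib_left square_integrable_add square_integrable_mult)
  show "(r + s) *\<^sub>R x = r *\<^sub>R x + s *\<^sub>R x"
    by transfer (simp add: L2_eq_def distrib_right square_integrable_add square_integrable_mult)
  show "r *\<^sub>R s *\<^sub>R x = (r * s) *\<^sub>R x"
    by transfer (simp add: L2_eq_def mult.assoc square_integrable_mult)
  show "1 *\<^sub>R x = x"
    by transfer (simp add: L2_eq_def)
  show "norm x = sqrt (inner x x)"
    by (rule norm_L2_half_line_def)
  show "dist x y = norm (x - y)"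
    by (rule dist_L2_half_line_def)
  show "sgn x = inverse (norm x) *\<^sub>R x"
    by (rule sgn_L2_half_line_def)
  show "uniformity = (INF e\<in>{0<..}. principal {(x::L2_half_line, y). dist x y < e})"
    by (rule uniformity_L2_half_line_def)
  show "open S = (\<forall>x\<in>S. \<forall>\<^sub>F (x', y) in uniformity. x' = x \<longrightarrow> y \<in> S)"
    by (rule open_L2_half_line_def)
  show "inner x y = inner y x"
  proof transfer
    fix f g
    have "(\<integral>t. f t * cnj (g t) \<partial>half_line) = (\<integral>t. cnj (g t * cnj (f t)) \<partial>half_line)"
      by (simp add: mult.commute)
    also have "\<dots> = cnj (\<integral>t. g t * cnj (f t) \<partial>half_line)"
      by (rule Bochner_Integration.integral_cnj)
    finally show "Re (\<integral>t. f t * cnj (g t) \<partial>half_line) = Re (\<integral>t. g t * cnj (f t) \<partial>half_line)"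
      by simp
  qed
  show "inner (x + y) z = inner x z + inner y z"
    by transfer (simp add: L2_eq_def distrib_right integrable_mult_cnj)
  show "inner (r *\<^sub>R x) y = r * inner x y"
    by transfer (simp add: mult.assoc)
  show "0 \<le> inner x x"
    by transfer (simp add: Re_integral_mult_cnj)
  show "(inner x x = 0) = (x = 0)"
  proof transfer
    fix f assume "L2_eq f f"
    then have "square_integrable f"
      by (simp add: L2_eq_def)
    then have int: "integrable half_line (\<lambda>t. (cmod (f t))\<^sup>2)"
      by (simp add: square_integrable_def)
    have "((\<integral>t. (cmod (f t))\<^sup>2 \<partial>half_line) = 0) = (AE t in half_line. f t = 0)"
      using integral_nonneg_eq_0_iff_AE [OF int] by simp
    then show "(Re (\<integral>t. f t * cnj (f t) \<partial>half_line) = 0) = L2_eq f (\<lambda>t. 0)"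
      using \<open>square_integrable f\<close>
      by (simp add: Re_integral_mult_cnj L2_eq_def square_integrable_0)
  qed
qed

end

instantiation L2_half_line :: complex_inner
begin

lift_definition scaleC_L2_half_line :: "complex \<Rightarrow> L2_half_line \<Rightarrow> L2_half_line"
  is "\<lambda>c f t. c * f t"
  by (auto simp: L2_eq_def square_integrable_mult)

lift_definition cinner_L2_half_line :: "L2_half_line \<Rightarrow> L2_half_line \<Rightarrow> complex"
  is "\<lambda>f g. \<integral>t. f t * cnj (g t) \<partial>half_line"
  by (intro integral_cong_AE borel_measurable_integrable integrable_mult_cnj)
    (auto simp: L2_eq_def)

instance
proof
  fix x y z :: L2_half_line and c d :: complex and r :: real
  show "c *\<^sub>C (x + y) = c *\<^sub>C x + c *\<^sub>C y"
    by transfer (simp add: L2_eq_def distrib_left square_integrable_add square_integrable_mult)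
  show "(c + d) *\<^sub>C x = c *\<^sub>C x + d *\<^sub>C x"
    by transfer (simp add: L2_eq_def distrib_right square_integrable_add square_integrable_mult)
  show "c *\<^sub>C d *\<^sub>C x = (c * d) *\<^sub>C x"
    by transfer (simp add: L2_eq_def mult.assoc square_integrable_mult)
  show "r *\<^sub>R x = complex_of_real r *\<^sub>C x"
    by transfer (simp add: L2_eq_def square_integrable_mult)
  show "cinner x y = cnj (cinner y x)"
    by transfer (simp add: mult.commute flip: Bochner_Integration.integral_cnj)
  show "cinner (x + y) z = cinner x z + cinner y z"
    by transfer (simp add: L2_eq_def distrib_right integrable_mult_cnj)
  show "cinner (c *\<^sub>C x) y = c * cinner x y"
    by transfer (simp add: mult.assoc)
  show "inner x y = Re (cinner x y)"
    by transfer simp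
qed

end

lift_definition backward_shift :: "L2_half_line \<Rightarrow> L2_half_line" is "\<lambda>f t. f (t + 1)"
proof -
  fix f g assume "L2_eq f g"
  then show "L2_eq (\<lambda>t. f (t + 1)) (\<lambda>t. g (t + 1))"
    using AE_half_line_shift [of "\<lambda>t. f t = g t"] by (simp add: L2_eq_def square_integrable_shift)
qed

end

theory Submission
  imports Defs
begin

text \<open>
  Subtracting a multiple of the identity from the generator of \<open>T\<close> leaves a semigroup
  \<open>S t = exp (- l t) T t\<close> with \<open>norm (S t) \<le> exp (\<omega> t)\<close> for some \<open>\<omega> < 0\<close>.  The theorem holds because
  \<open>S\<close> is then even unitarily equivalent to a restriction of \<open>U\<close>.  This is seen on the cogenerators,
  where it is the shift model of a stable contraction.

  Let \<open>A\<close> be the generator of \<open>S\<close>, let \<open>H\<close> be the inverse of \<open>A - 1\<close> (\<open>resolvent_at_1\<close>), and let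
  \<open>W = 1 + 2 H\<close> be the cogenerator.  Since \<open>Re (cinner (A x) x) \<le> \<omega> (norm x)\<^sup>2\<close>, the number
  \<open>(norm z)\<^sup>2 - (norm (W z))\<^sup>2 = - 4 Re (cinner (A (H z)) (H z))\<close> is at least
  \<open>- 4 \<omega> (norm (H z))\<^sup>2\<close>.  So \<open>W\<close> is a contraction, and summing this over the powers of \<open>W\<close> shows that
  \<open>W ^^ n\<close> tends to 0 on the range of \<open>H\<close>, which is dense: thus everywhere (\<open>stable_cogenerator\<close>).

  For such a \<open>W\<close>, the defect form \<open>q x y = cinner x y - cinner (W x) (W y)\<close> telescopes along
  orbits: \<open>(norm x)\<^sup>2\<close> is the sum over \<open>k\<close> of \<open>q x\<^sub>k x\<^sub>k\<close>, where \<open>x\<^sub>k = (W ^^ k) x\<close>.  By separability, \<open>q\<close> is a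
  sum of squares of moduli of countably many linear functionals \<open>f n\<close>
  (\<open>psd_form_sum_of_squares\<close>).  Cut each interval \<open>[k, k + 1)\<close> into countably many cells, following the same
  pattern for every \<open>k\<close>, and let \<open>J x\<close> be the function that on the \<open>n\<close>-th cell of the \<open>k\<close>-th interval is constant
  with squared norm \<open>(cmod (f n x\<^sub>k))\<^sup>2\<close>.  Then \<open>J\<close> is an isometry, and replacing \<open>x\<close> by \<open>W x\<close> shifts \<open>J x\<close> to
  the left by 1 (\<open>backward_shift_model\<close>).

  It remains to return from cogenerators to semigroups.  The relation between \<open>J\<close>, \<open>W\<close> and the
  backward shift says that \<open>J\<close> maps the graph of the generator of \<open>S\<close> into that of the
  generator of \<open>U\<close>.  Hence \<open>J (S t x)\<close> and \<open>U t (J x)\<close> solve the same evolution equation with the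
  same initial value, and they agree because the generator of \<open>U\<close>, whose cogenerator is a
  contraction, is dissipative (\<open>semigroups_intertwine\<close>).  The theorem follows with the range of
  \<open>J\<close> as \<open>M\<close> and the inverse of \<open>J\<close> as \<open>R\<close>.
\<close>

section \<open>Linear maps between complex inner product spaces\<close>

instance chilbert_space \<subseteq> banach ..

lemma bounded_clinearD:
  assumes "bounded_clinear f"
  shows "f (x + y) = f x + f y" "f (c *\<^sub>C x) = c *\<^sub>C f x" "bounded_linear f"
proof -
  interpret Vector_Spaces.linear scaleC scaleC f
    using assms by (simp add: bounded_clinear_def)
  show *: "f (x + y) = f x + f y" "f (c *\<^sub>C x) = c *\<^sub>C f x" for x y c
    by (rule add scale)+
  show "bounded_linear f"
    using assms by (auto simp: bounded_clinear_def bounded_linear_def bounded_linear_axioms_def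
        * scaleR_eq_scaleC intro!: linearI)
qed

lemma norm_scaleC: "norm (c *\<^sub>C x) = cmod c * norm x"
proof -
  have "cinner (c *\<^sub>C x) (c *\<^sub>C x) = c * cnj c * cinner x x"
    using cinner_commute [of x "c *\<^sub>C x"] cinner_commute [of x x]
    by (simp add: cinner_scaleC_left)
  then have "complex_of_real ((norm (c *\<^sub>C x))\<^sup>2) = complex_of_real ((cmod c * norm x)\<^sup>2)"
    unfolding cinner_self complex_norm_square [symmetric] by (simp add: power_mult_distrib)
  then have "(norm (c *\<^sub>C x))\<^sup>2 = (cmod c * norm x)\<^sup>2"
    by (simp only: of_real_eq_iff)
  then show ?thesis
    by (simp add: power2_eq_iff_nonneg)
qed

lemma bounded_clinearI:
  assumes "\<And>x y. f (x + y) = f x + f y" "\<And>c x. f (c *\<^sub>C x) = c *\<^sub>C f x"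
    "\<And>x. norm (f x) \<le> norm x * K"
  shows "bounded_clinear f"
  unfolding bounded_clinear_def
proof
  show "Vector_Spaces.linear scaleC scaleC f"
    by unfold_locales (fact assms(1,2))+
qed (use assms(3) in blast)

lemma bounded_linear_scaleC: "bounded_linear (\<lambda>x. c *\<^sub>C x)"
  by (rule bounded_linear_intro [where K = "cmod c"])
    (simp_all add: norm_scaleC scaleC_add_right scaleR_eq_scaleC scaleC_scaleC mult.commute)

lemma bounded_linear_isometry:
  fixes J :: "'a::complex_inner \<Rightarrow> 'b::complex_inner"
  assumes "\<And>x y. J (x + y) = J x + J y" "\<And>c x. J (c *\<^sub>C x) = c *\<^sub>C J x"
    "\<And>x. norm (J x) = norm x"
  shows "bounded_linear J"
  by (rule bounded_clinearD(3), rule bounded_clinearI[where K = 1]) (simp_all add: assms)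

section \<open>Positive semidefinite forms are sums of squares\<close>

definition psd_form :: "('a::complex_inner \<Rightarrow> 'a \<Rightarrow> complex) \<Rightarrow> bool" where
  "psd_form q \<longleftrightarrow>
     (\<forall>x y z. q (x + y) z = q x z + q y z) \<and> (\<forall>c x y. q (c *\<^sub>C x) y = c * q x y) \<and>
     (\<forall>x y. q x y = cnj (q y x)) \<and> (\<forall>x. 0 \<le> Re (q x x))"

lemma psd_formD:
  assumes "psd_form q"
  shows "q (x + y) z = q x z + q y z" "q (c *\<^sub>C x) y = c * q x y" "q x y = cnj (q y x)"
    "0 \<le> Re (q x x)"
  using assms unfolding psd_form_def by blast+

lemma psd_form_right:
  assumes "psd_form q"
  shows "q x (y + z) = q x y + q x z" "q x (c *\<^sub>C y) = cnj c * q x y"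
  using psd_formD(1,2)[OF assms] psd_formD(3)[OF assms, of x] by simp_all

text \<open>
  Without definiteness the usual division by \<open>q y y\<close> can fail; then \<open>q (x - c y) (x - c y)\<close> is affine
  in \<open>r\<close> along \<open>c = r q x y\<close>, and it can only stay nonnegative if \<open>q x y = 0\<close>.
\<close>

lemma psd_form_Cauchy_Schwarz:
  assumes q: "psd_form q"
  shows "(cmod (q x y))\<^sup>2 \<le> Re (q x x) * Re (q y y)"
proof -
  note q' = psd_formD[OF q] psd_form_right[OF q]
  have im: "Im (q y y) = 0"
    using q'(3)[of y y] by (simp add: complex_eq_iff)
  have expand: "0 \<le> Re (q x x) - 2 * r * (cmod (q x y))\<^sup>2 + r\<^sup>2 * (cmod (q x y))\<^sup>2 * Re (q y y)"
    for r :: real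
  proof -
    let ?c = "- (complex_of_real r * q x y)"
    have "q (x + ?c *\<^sub>C y) (x + ?c *\<^sub>C y)
        = q x x + cnj ?c * q x y + ?c * cnj (q x y) + ?c * cnj ?c * q y y"
      using q'(3)[of y x] by (simp only: q'(1,2,5,6)) (simp add: algebra_simps)
    then have "Re (q (x + ?c *\<^sub>C y) (x + ?c *\<^sub>C y))
        = Re (q x x) - 2 * r * (cmod (q x y))\<^sup>2 + r\<^sup>2 * (cmod (q x y))\<^sup>2 * Re (q y y)"
      by (simp add: cmod_power2 im) (simp add: algebra_simps power2_eq_square)
    with q'(4) show ?thesis
      by metis
  qed
  show ?thesis
  proof (cases "Re (q y y) = 0")
    case True
    have "cmod (q x y) = 0"
    proof (rule ccontr)
      assume "cmod (q x y) \<noteq> 0"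
      then show False
        using expand [of "(Re (q x x) + 1) / (cmod (q x y))\<^sup>2"] q'(4)[of x] True by simp
    qed
    then show ?thesis
      using True by simp
  next
    case False
    then have "0 < Re (q y y)"
      using q'(4)[of y] by simp
    then show ?thesis
      using expand [of "1 / Re (q y y)"] by (simp add: field_simps power2_eq_square)
  qed
qed

text \<open>
  One step of a Cholesky factorization: the multiple of \<open>\<lambda>y. q y v\<close> whose squared modulus has
  to be subtracted from \<open>q\<close> in order to make the form vanish at \<open>v\<close>.  If \<open>q v v = 0\<close>, then
  division by zero yields the zero functional, as it should: by the Cauchy-Schwarz
  inequality, \<open>\<lambda>y. q y v\<close> vanishes as well.
\<close>

definition pivot :: "'a \<Rightarrow> ('a \<Rightarrow> 'a \<Rightarrow> complex) \<Rightarrow> 'a \<Rightarrow> complex" where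
  "pivot v q y = q y v / complex_of_real (sqrt (Re (q v v)))"

primrec cholesky :: "(nat \<Rightarrow> 'a) \<Rightarrow> ('a \<Rightarrow> 'a \<Rightarrow> complex) \<Rightarrow> nat \<Rightarrow> 'a \<Rightarrow> 'a \<Rightarrow> complex" where
  "cholesky v q 0 = q"
| "cholesky v q (Suc n) = (\<lambda>y z. cholesky v q n y z
     - pivot (v n) (cholesky v q n) y * cnj (pivot (v n) (cholesky v q n) z))"

lemma pivot_square:
  assumes "psd_form q"
  shows "(cmod (pivot v q y))\<^sup>2 = (cmod (q y v))\<^sup>2 / Re (q v v)"
  using psd_formD(4)[OF assms, of v]
  by (simp add: pivot_def norm_divide power_divide)

lemma cholesky_diagonal:
  "Re (cholesky v q (Suc n) y y)
    = Re (cholesky v q n y y) - (cmod (pivot (v n) (cholesky v q n) y))\<^sup>2"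
  by (simp add: cmod_power2) (simp add: power2_eq_square)

text \<open>
  Positivity survives a step because the subtracted square is \<open>(cmod (q y v))\<^sup>2 / q v v\<close>, which the
  Cauchy-Schwarz inequality bounds by \<open>q y y\<close>.
\<close>

lemma psd_form_cholesky:
  assumes "psd_form q"
  shows "psd_form (cholesky v q n)"
proof (induction n)
  case (Suc n)
  let ?q = "cholesky v q n"
  note q' = psd_formD[OF Suc] psd_form_right[OF Suc]
  have "0 \<le> Re (cholesky v q (Suc n) y y)" for y
  proof -
    have "(cmod (?q y (v n)))\<^sup>2 / Re (?q (v n) (v n)) \<le> Re (?q y y)"
      using psd_form_Cauchy_Schwarz[OF Suc, of y "v n"] q'(4)[of "v n"] q'(4)[of y]
      by (cases "Re (?q (v n) (v n)) = 0") (simp_all add: divide_le_eq)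
    then show ?thesis
      by (simp only: cholesky_diagonal pivot_square[OF Suc] diff_ge_0_iff_ge)
  qed
  moreover have "cholesky v q (Suc n) (x + y) z = cholesky v q (Suc n) x z + cholesky v q (Suc n) y z"
    for x y z
    by (simp add: pivot_def q'(1) add_divide_distrib algebra_simps)
  moreover have "cholesky v q (Suc n) (c *\<^sub>C x) y = c * cholesky v q (Suc n) x y" for c x y
    by (simp add: pivot_def q'(2) algebra_simps)
  moreover have "cholesky v q (Suc n) x y = cnj (cholesky v q (Suc n) y x)" for x y
    using q'(3)[of x y] by (simp add: mult.commute)
  ultimately show ?case
    unfolding psd_form_def by blast
qed (simp add: assms)

lemma cholesky_antimono:
  assumes "psd_form q" "m \<le> n"
  shows "Re (cholesky v q n y y) \<le> Re (cholesky v q m y y)"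
  by (rule lift_Suc_antimono_le[OF _ \<open>m \<le> n\<close>]) (simp only: cholesky_diagonal, simp)

lemma cholesky_eliminates:
  assumes "psd_form q" "m < n"
  shows "Re (cholesky v q n (v m) (v m)) \<le> 0"
proof -
  note c = psd_form_cholesky[OF assms(1), of v m]
  have "(cmod (cholesky v q m (v m) (v m)))\<^sup>2 = (Re (cholesky v q m (v m) (v m)))\<^sup>2"
    using psd_formD(3)[OF c, of "v m" "v m"] by (simp add: cmod_power2 complex_eq_iff)
  then have "Re (cholesky v q (Suc m) (v m) (v m)) = 0"
    by (simp only: cholesky_diagonal pivot_square[OF c]) (simp add: power2_eq_square)
  then show ?thesis
    using cholesky_antimono[OF assms(1), of "Suc m" n v "v m"] assms(2) by simp
qed

text \<open>
  Pivoting along a dense sequence exhausts a bounded form: at step \<open>n\<close> the remainder vanishes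
  at the first \<open>n\<close> points of the sequence and is still dominated by the norm, so it is small at
  every point that one of those approximates.
\<close>

lemma psd_form_sum_of_squares:
  fixes q :: "'a::complex_inner \<Rightarrow> 'a \<Rightarrow> complex"
  assumes q: "psd_form q" and le: "\<And>x. Re (q x x) \<le> (norm x)\<^sup>2"
    and sep: "separable_space (euclidean :: 'a topology)"
  obtains f :: "nat \<Rightarrow> 'a \<Rightarrow> complex"
  where "\<And>n x y. f n (x + y) = f n x + f n y" "\<And>n c x. f n (c *\<^sub>C x) = c * f n x"
    "\<And>y. (\<lambda>n. (cmod (f n y))\<^sup>2) sums Re (q y y)"
proof -
  obtain D :: "'a set" where D: "countable D" "closure D = UNIV"
    using sep by (auto simp: separable_space_def)
  then have "D \<noteq> {}"
    by auto
  define v where "v = from_nat_into D"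
  have v: "range v = D"
    using D(1) \<open>D \<noteq> {}\<close> by (simp add: v_def range_from_nat_into)
  define f where "f n = pivot (v n) (cholesky v q n)" for n
  note psd = psd_form_cholesky[OF q, of v]
  note c = psd_formD[OF psd] psd_form_right[OF psd]
  have partial: "(\<Sum>n<m. (cmod (f n y))\<^sup>2) = Re (q y y) - Re (cholesky v q m y y)" for m y
  proof (induction m)
    case (Suc m)
    then show ?case
      by (simp only: sum.lessThan_Suc cholesky_diagonal f_def)
  qed simp
  have "(\<lambda>m. Re (cholesky v q m y y)) \<longlonglongrightarrow> 0" for y
  proof (rule LIMSEQ_I)
    fix e :: real assume "0 < e"
    have "y \<in> closure D"
      using D(2) by simp
    moreover have "0 < sqrt (e / 2)"
      using \<open>0 < e\<close> by simp
    ultimately obtain k where k: "dist (v k) y < sqrt (e / 2)"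
      unfolding closure_approachable using v by (metis imageE)
    show "\<exists>m0. \<forall>m\<ge>m0. norm (Re (cholesky v q m y y) - 0) < e"
    proof (intro exI allI impI)
      fix m assume "Suc k \<le> m"
      let ?p = "cholesky v q m" and ?d = "y + (-1) *\<^sub>C v k"
      have d: "?d = y - v k"
        using scaleR_eq_scaleC [of "-1" "v k"] by simp
      (* the parallelogram identity for y - v k and v k, which add up to y and differ by y - 2 v k *)
      have "Re (?p y y) \<le> Re (?p y y) + Re (?p (y + (-2) *\<^sub>C v k) (y + (-2) *\<^sub>C v k))"
        using c(4) by simp
      also have "\<dots> = 2 * Re (?p ?d ?d) + 2 * Re (?p (v k) (v k))"
        by (simp only: c(1,2,5,6)) (simp add: algebra_simps)
      also have "\<dots> \<le> 2 * Re (?p ?d ?d)"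
        using cholesky_eliminates[OF q, of k m v] \<open>Suc k \<le> m\<close> by simp
      also have "\<dots> \<le> 2 * (norm ?d)\<^sup>2"
        using cholesky_antimono[OF q, of 0 m v ?d] le[of ?d] by simp
      also have "\<dots> < e"
        using real_sqrt_less_iff[of "(norm ?d)\<^sup>2" "e / 2"] k
        by (simp add: d dist_norm norm_minus_commute)
      finally show "norm (Re (?p y y) - 0) < e"
        using c(4) by simp
    qed
  qed
  then have "(\<lambda>m. Re (q y y) - Re (cholesky v q m y y)) \<longlonglongrightarrow> Re (q y y) - 0" for y
    by (intro tendsto_intros)
  then have "(\<lambda>n. (cmod (f n y))\<^sup>2) sums Re (q y y)" for y
    by (simp add: sums_def partial)
  moreover have "f n (x + y) = f n x + f n y" "f n (a *\<^sub>C x) = a * f n x" for n x y a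
    by (simp_all add: f_def pivot_def c(1,2) add_divide_distrib)
  ultimately show thesis
    using that by blast
qed

section \<open>Semigroups and their generators\<close>

lemma C0_semigroupD:
  assumes "C0_semigroup T"
  shows "T 0 x = x" "0 \<le> s \<Longrightarrow> 0 \<le> t \<Longrightarrow> T (s + t) x = T s (T t x)"
    "0 \<le> t \<Longrightarrow> bounded_linear (T t)" "0 \<le> t \<Longrightarrow> T t (c *\<^sub>C x) = c *\<^sub>C T t x"
    "continuous_on {0..} (\<lambda>t. T t x)"
proof -
  note T = assms[unfolded C0_semigroup_def]
  show "T 0 x = x" "continuous_on {0..} (\<lambda>t. T t x)"
    using T by simp_all
  show "T (s + t) x = T s (T t x)" if "0 \<le> s" "0 \<le> t"
  proof -
    have "T (s + t) = T s \<circ> T t"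
      using T that by blast
    then show ?thesis
      by simp
  qed
  have clinear: "bounded_clinear (T t)" if "0 \<le> t"
    using T that by blast
  show "bounded_linear (T t)" if "0 \<le> t"
    by (rule bounded_clinearD(3)[OF clinear[OF that]])
  show "T t (c *\<^sub>C x) = c *\<^sub>C T t x" if "0 \<le> t"
    by (rule bounded_clinearD(2)[OF clinear[OF that]])
qed

text \<open>
  Membership in the domain and the value of the generator in one relation: its closure
  properties are then limit theorems, without separate bookkeeping for the domain.
\<close>

definition generator_graph :: "(real \<Rightarrow> 'a::complex_inner \<Rightarrow> 'a) \<Rightarrow> 'a \<Rightarrow> 'a \<Rightarrow> bool" where
  "generator_graph T x y \<longleftrightarrow> ((\<lambda>h. (T h x - x) /\<^sub>R h) \<longlongrightarrow> y) (at_right 0)"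

lemma generator_graph_iff:
  "generator_graph T x y \<longleftrightarrow> x \<in> generator_domain T \<and> generator T x = y"
proof
  assume "generator_graph T x y"
  then show "x \<in> generator_domain T \<and> generator T x = y"
    unfolding generator_graph_def generator_domain_def generator_def
    by (auto intro!: tendsto_Lim)
next
  assume *: "x \<in> generator_domain T \<and> generator T x = y"
  then obtain z where z: "((\<lambda>h. (T h x - x) /\<^sub>R h) \<longlongrightarrow> z) (at_right 0)"
    by (auto simp: generator_domain_def)
  then have "generator T x = z"
    unfolding generator_def by (intro tendsto_Lim) auto
  with z * show "generator_graph T x y"
    by (simp add: generator_graph_def)
qed

lemma generator_graph_add:
  assumes "C0_semigroup T" "generator_graph T x y" "generator_graph T x' y'"
  shows "generator_graph T (x + x') (y + y')"
proof -
  have "((\<lambda>h. (T h x - x) /\<^sub>R h + (T h x' - x') /\<^sub>R h) \<longlongrightarrow> y + y') (at_right 0)"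
    using assms(2,3) unfolding generator_graph_def by (rule tendsto_add)
  moreover have "\<forall>\<^sub>F h in at_right 0.
      (T h x - x) /\<^sub>R h + (T h x' - x') /\<^sub>R h = (T h (x + x') - (x + x')) /\<^sub>R h"
    using eventually_at_right_less [of "0::real"]
    by eventually_elim
      (simp add: linear_add bounded_linear.linear C0_semigroupD(3)[OF assms(1)] algebra_simps)
  ultimately show ?thesis
    unfolding generator_graph_def by (rule Lim_transform_eventually)
qed

lemma generator_graph_scaleC:
  assumes "C0_semigroup T" "generator_graph T x y"
  shows "generator_graph T (c *\<^sub>C x) (c *\<^sub>C y)"
proof -
  interpret bounded_linear "\<lambda>x. c *\<^sub>C (x::'a)"
    by (rule bounded_linear_scaleC)
  have "((\<lambda>h. c *\<^sub>C ((T h x - x) /\<^sub>R h)) \<longlongrightarrow> c *\<^sub>C y) (at_right 0)"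
    using assms(2) unfolding generator_graph_def by (rule tendsto)
  moreover have "\<forall>\<^sub>F h in at_right 0.
      c *\<^sub>C ((T h x - x) /\<^sub>R h) = (T h (c *\<^sub>C x) - c *\<^sub>C x) /\<^sub>R h"
    using eventually_at_right_less [of "0::real"]
    by eventually_elim (simp add: C0_semigroupD(4)[OF assms(1)] scale diff)
  ultimately show ?thesis
    unfolding generator_graph_def by (rule Lim_transform_eventually)
qed

lemma generator_graph_diff:
  assumes "C0_semigroup T" "generator_graph T x y" "generator_graph T x' y'"
  shows "generator_graph T (x - x') (y - y')"
  using generator_graph_add[OF assms(1,2) generator_graph_scaleC[OF assms(1,3), of "-1"]]
    scaleR_eq_scaleC[of "-1" x'] scaleR_eq_scaleC[of "-1" y'] by simp

text \<open>
  Only the derivative from the right is obtained, since that takes just the continuity of the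
  single operator \<open>T t\<close>; the derivative from the left would need a bound on \<open>T s\<close> that is uniform
  for \<open>s\<close> near \<open>t\<close>.
\<close>

lemma generator_graph_orbit:
  assumes "C0_semigroup T" "generator_graph T x y" "0 \<le> t"
  shows "generator_graph T (T t x) (T t y)"
    and "((\<lambda>h. (T (t + h) x - T t x) /\<^sub>R h) \<longlongrightarrow> T t y) (at_right 0)"
proof -
  note D = C0_semigroupD[OF assms(1)]
  interpret bounded_linear "T t"
    by (rule D(3)[OF assms(3)])
  have lim: "((\<lambda>h. T t ((T h x - x) /\<^sub>R h)) \<longlongrightarrow> T t y) (at_right 0)"
    using assms(2) unfolding generator_graph_def by (rule tendsto)
  have 1: "\<forall>\<^sub>F h in at_right 0. T t ((T h x - x) /\<^sub>R h) = (T (t + h) x - T t x) /\<^sub>R h"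
    using eventually_at_right_less [of "0::real"]
    by eventually_elim (use assms(3) in \<open>simp add: D(2) scale diff\<close>)
  then show "((\<lambda>h. (T (t + h) x - T t x) /\<^sub>R h) \<longlongrightarrow> T t y) (at_right 0)"
    by (rule Lim_transform_eventually[OF lim])
  have 2: "T (t + h) x = T h (T t x)" if "0 < h" for h
    using D(2)[of h t x] that assms(3) by (simp add: add.commute)
  have "\<forall>\<^sub>F h in at_right 0. T t ((T h x - x) /\<^sub>R h) = (T h (T t x) - T t x) /\<^sub>R h"
    using 1 eventually_at_right_less [of "0::real"] by eventually_elim (simp only: 2)
  then show "generator_graph T (T t x) (T t y)"
    unfolding generator_graph_def by (rule Lim_transform_eventually[OF lim])
qed

lemma exp_difference_quotient: "((\<lambda>h. (exp (c * h) - 1) / h) \<longlongrightarrow> (c::real)) (at_right 0)"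
proof -
  have "((\<lambda>h. exp (c * h)) has_field_derivative c) (at 0)"
    by (auto intro!: derivative_eq_intros)
  then show ?thesis
    unfolding DERIV_def by (auto intro: filterlim_mono simp: at_le)
qed

lemma C0_semigroup_rescale:
  assumes "C0_semigroup T"
  shows "C0_semigroup (\<lambda>t x. exp (c * t) *\<^sub>R T t x)"
proof -
  note D = C0_semigroupD[OF assms]
  have "bounded_clinear (\<lambda>x. exp (c * t) *\<^sub>R T t x)" if "0 \<le> t" for t
  proof -
    interpret bounded_linear "T t"
      by (rule D(3)[OF that])
    obtain K where K: "norm (T t x) \<le> norm x * K" for x
      using bounded by blast
    have "exp (c * t) * norm (T t x) \<le> exp (c * t) * (norm x * K)" for x
      using K by (intro mult_left_mono) auto
    then show ?thesis
      by (intro bounded_clinearI [where K = "exp (c * t) * K"])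
        (simp_all add: add D(4)[OF that] scaleC_add_right scaleR_eq_scaleC scaleC_scaleC
          norm_scaleC mult.commute mult.left_commute)
  qed
  moreover have "exp (c * (s + t)) *\<^sub>R T (s + t) x
      = exp (c * s) *\<^sub>R T s (exp (c * t) *\<^sub>R T t x)" if "0 \<le> s" "0 \<le> t" for s t x
    using that linear_scale[OF bounded_linear.linear[OF D(3)[OF that(1)]]]
    by (simp add: D(2) distrib_left exp_add)
  moreover have "continuous_on {0..} (\<lambda>t. exp (c * t) *\<^sub>R T t x)" for x
    by (intro continuous_intros D(5))
  ultimately show ?thesis
    by (auto simp: C0_semigroup_def fun_eq_iff D(1))
qed

lemma generator_graph_rescale:
  assumes "generator_graph T x y"
  shows "generator_graph (\<lambda>t x. exp (c * t) *\<^sub>R T t x) x (y + c *\<^sub>R x)"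
proof -
  have "((\<lambda>h. exp (c * h)) \<longlongrightarrow> exp (c * 0)) (at_right 0)"
    by (intro tendsto_intros)
  then have "((\<lambda>h. exp (c * h) *\<^sub>R ((T h x - x) /\<^sub>R h) + ((exp (c * h) - 1) / h) *\<^sub>R x)
      \<longlongrightarrow> exp (c * 0) *\<^sub>R y + c *\<^sub>R x) (at_right 0)"
    using assms unfolding generator_graph_def
    by (intro tendsto_add tendsto_scaleR exp_difference_quotient tendsto_const)
  moreover have "exp (c * h) *\<^sub>R ((T h x - x) /\<^sub>R h) + ((exp (c * h) - 1) / h) *\<^sub>R x
      = (exp (c * h) *\<^sub>R T h x - x) /\<^sub>R h" for h
    by (simp add: divide_inverse algebra_simps)
  ultimately show ?thesis
    by (simp add: generator_graph_def)
qed

lemma right_derivative_orbit_integral: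
  fixes T :: "real \<Rightarrow> 'a::chilbert_space \<Rightarrow> 'a"
  assumes "C0_semigroup T" "0 \<le> u"
  shows "((\<lambda>r. (integral {0..u + r} (\<lambda>s. T s x) - integral {0..u} (\<lambda>s. T s x)) /\<^sub>R r)
    \<longlongrightarrow> T u x) (at_right 0)"
proof -
  let ?F = "\<lambda>u. integral {0..u} (\<lambda>s. T s x)"
  have "(?F has_vector_derivative T u x) (at u within {0..u + 1})"
    using assms by (intro integral_has_vector_derivative
        continuous_on_subset[OF C0_semigroupD(5)[OF assms(1)]]) auto
  then have "(?F has_vector_derivative T u x) (at u within {u..u + 1})"
    by (rule has_vector_derivative_within_subset) (use assms(2) in auto)
  then have "((\<lambda>y. (1 / norm (y - u)) *\<^sub>R (?F y - (?F u + (y - u) *\<^sub>R T u x)) + T u x)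
      \<longlongrightarrow> 0 + T u x) (at_right u)"
    unfolding has_vector_derivative_def has_derivative_within
    by (intro tendsto_add tendsto_const) (simp add: at_within_Icc_at_right)
  moreover have "\<forall>\<^sub>F y in at_right u.
      (1 / norm (y - u)) *\<^sub>R (?F y - (?F u + (y - u) *\<^sub>R T u x)) + T u x
      = (?F y - ?F u) /\<^sub>R (y - u)"
    using eventually_at_right_less [of u]
    by eventually_elim (simp add: divide_inverse scaleR_diff_right scaleR_add_right)
  ultimately have "((\<lambda>y. (?F y - ?F u) /\<^sub>R (y - u)) \<longlongrightarrow> 0 + T u x) (at_right u)"
    by (rule Lim_transform_eventually)
  then show ?thesis
    by (subst (asm) at_right_to_0) (simp add: filterlim_filtermap add.commute)
qed

text \<open>
  Applying \<open>T r\<close> to the integral moves the interval of integration to \<open>[r, h + r]\<close>, so that the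
  difference quotient is made of two means of the orbit, over \<open>[h, h + r]\<close> and over \<open>[0, r]\<close>.
\<close>

lemma generator_graph_orbit_integral:
  fixes T :: "real \<Rightarrow> 'a::chilbert_space \<Rightarrow> 'a"
  assumes "C0_semigroup T" "0 \<le> h"
  shows "generator_graph T (integral {0..h} (\<lambda>s. T s x)) (T h x - x)"
proof -
  note D = C0_semigroupD[OF assms(1)]
  let ?F = "\<lambda>u. integral {0..u} (\<lambda>s. T s x)"
  have int: "(\<lambda>s. T s x) integrable_on {a..b}" if "0 \<le> a" for a b
    using that by (intro integrable_continuous_real continuous_on_subset[OF D(5)]) auto
  have lim: "((\<lambda>r. (?F (h + r) - ?F h) /\<^sub>R r - (?F (0 + r) - ?F 0) /\<^sub>R r) \<longlongrightarrow> T h x - T 0 x)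
      (at_right 0)"
    using assms by (intro tendsto_diff right_derivative_orbit_integral) auto
  have "(?F (h + r) - ?F h) /\<^sub>R r - (?F (0 + r) - ?F 0) /\<^sub>R r = (T r (?F h) - ?F h) /\<^sub>R r"
    if "0 < r" for r
  proof -
    have "T r (?F h) = integral {0..h} (T r \<circ> (\<lambda>s. T s x))"
      using int[of 0 h] D(3)[of r] that by (simp add: integral_linear)
    also have "\<dots> = integral {0..h} (\<lambda>s. T (s + r) x)"
      using that by (intro integral_cong) (simp add: D(2) add.commute[of _ r])
    also have "\<dots> = integral {r..h + r} (\<lambda>s. T s x)"
      using integral_shift_Icc_real[of 0 h "\<lambda>s. T s x" r] by (simp add: o_def add.commute)
    also have "\<dots> = ?F (h + r) - ?F r"
      using Henstock_Kurzweil_Integration.integral_combine[of 0 r "h + r" "\<lambda>s. T s x"]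
        int[of 0] that assms(2) by (simp add: algebra_simps)
    finally show ?thesis
      by (simp add: scaleR_diff_right)
  qed
  then have "\<forall>\<^sub>F r in at_right 0. (?F (h + r) - ?F h) /\<^sub>R r - (?F (0 + r) - ?F 0) /\<^sub>R r
      = (T r (?F h) - ?F h) /\<^sub>R r"
    using eventually_at_right_less [of "0::real"] by (auto elim: eventually_mono)
  from Lim_transform_eventually[OF lim this] show ?thesis
    by (simp add: generator_graph_def D(1))
qed

text \<open>The mean of an orbit over \<open>[0, r]\<close> lies in the domain and tends to its starting point.\<close>

lemma generator_domain_dense:
  fixes T :: "real \<Rightarrow> 'a::chilbert_space \<Rightarrow> 'a"
  assumes "C0_semigroup T"
  shows "closure {x. \<exists>y. generator_graph T x y} = UNIV"
proof -
  have "x \<in> closure {x. \<exists>y. generator_graph T x y}" for x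
  proof (rule Lim_in_closed_set)
    show "((\<lambda>r. integral {0..r} (\<lambda>s. T s x) /\<^sub>R r) \<longlongrightarrow> x) (at_right 0)"
      using right_derivative_orbit_integral[OF assms, of 0 x] by (simp add: C0_semigroupD(1)[OF assms])
    show "\<forall>\<^sub>F r in at_right 0. integral {0..r} (\<lambda>s. T s x) /\<^sub>R r
        \<in> closure {x. \<exists>y. generator_graph T x y}"
      using eventually_at_right_less [of "0::real"]
    proof eventually_elim
      case (elim r)
      have "generator_graph T (integral {0..r} (\<lambda>s. T s x) /\<^sub>R r) ((T r x - x) /\<^sub>R r)"
        unfolding scaleR_eq_scaleC using elim
        by (intro generator_graph_scaleC generator_graph_orbit_integral assms) simp
      then show ?case
        by (intro subsetD[OF closure_subset] CollectI exI)
    qed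
  qed auto
  then show ?thesis
    by blast
qed

lemma generator_numerical_range:
  assumes "\<And>t x. 0 \<le> t \<Longrightarrow> norm (T t x) \<le> exp (\<omega> * t) * norm x"
    and "generator_graph T x y"
  shows "inner y x \<le> \<omega> * (norm x)\<^sup>2"
proof (rule tendsto_le)
  show "((\<lambda>h. inner ((T h x - x) /\<^sub>R h) x) \<longlongrightarrow> inner y x) (at_right 0)"
    using assms(2) unfolding generator_graph_def by (intro tendsto_intros)
  show "((\<lambda>h. (exp (\<omega> * h) - 1) / h * (norm x)\<^sup>2) \<longlongrightarrow> \<omega> * (norm x)\<^sup>2) (at_right 0)"
    by (intro tendsto_mult exp_difference_quotient tendsto_const)
  show "\<forall>\<^sub>F h in at_right 0. inner ((T h x - x) /\<^sub>R h) x \<le> (exp (\<omega> * h) - 1) / h * (norm x)\<^sup>2"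
    using eventually_at_right_less [of "0::real"]
  proof eventually_elim
    case (elim h)
    have "inner (T h x) x \<le> norm (T h x) * norm x"
      by (rule norm_cauchy_schwarz)
    also have "\<dots> \<le> exp (\<omega> * h) * norm x * norm x"
      using assms(1) elim by (intro mult_right_mono) auto
    finally have "inner (T h x - x) x \<le> (exp (\<omega> * h) - 1) * (norm x)\<^sup>2"
      by (simp add: inner_diff_left power2_norm_eq_inner[symmetric] power2_eq_square algebra_simps)
    then have "inner (T h x - x) x / h \<le> (exp (\<omega> * h) - 1) * (norm x)\<^sup>2 / h"
      using elim by (intro divide_right_mono) auto
    then show ?case
      by (simp add: divide_inverse mult_ac)
  qed
qed simp

text \<open>
  For \<open>\<omega> < 1\<close>, the rescaled semigroup \<open>P t = exp (- t) T t\<close>, whose generator is \<open>A - 1\<close>, satisfies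
  \<open>norm (P 1) < 1\<close>.  So \<open>P 1 z - z = x\<close> is solvable by Banach's fixed point theorem, and the integral
  of \<open>P s z\<close> over \<open>[0, 1]\<close> is a solution \<open>y\<close> of \<open>A y - y = x\<close>.  There is no other, because
  \<open>Re (cinner (A u) u) \<le> \<omega> (norm u)\<^sup>2\<close> rules out \<open>A u = u\<close> for \<open>u \<noteq> 0\<close>.
\<close>

lemma resolvent_at_1:
  fixes T :: "real \<Rightarrow> 'a::chilbert_space \<Rightarrow> 'a"
  assumes T: "C0_semigroup T" and \<omega>: "\<omega> < 1"
    and le: "\<And>t x. 0 \<le> t \<Longrightarrow> norm (T t x) \<le> exp (\<omega> * t) * norm x"
  obtains H where "\<And>z. generator_graph T (H z) (z + H z)"
    "\<And>x y. generator_graph T x y \<Longrightarrow> H (y - x) = x"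
    "\<And>x y. H (x + y) = H x + H y" "\<And>c x. H (c *\<^sub>C x) = c *\<^sub>C H x"
proof -
  define P where "P = (\<lambda>t x. exp ((-1) * t) *\<^sub>R T t x)"
  have P: "C0_semigroup P"
    unfolding P_def by (rule C0_semigroup_rescale[OF T])
  have ex: "\<exists>y. generator_graph T y (x + y)" for x
  proof -
    interpret bounded_linear "P 1"
      using C0_semigroupD(3)[OF P] by simp
    have "norm (P 1 z) \<le> exp (\<omega> - 1) * norm z" for z
      using le[of 1 z] by (simp add: P_def exp_diff exp_minus field_simps)
    then have "\<exists>!z. P 1 z - x = z"
      using \<omega> by (intro banach_fix_type[where c = "exp (\<omega> - 1)"])
        (simp_all add: dist_norm flip: diff)
    then obtain z where z: "P 1 z - x = z"
      by blast
    define y where "y = integral {0..1} (\<lambda>s. P s z)"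
    have "generator_graph P y (P 1 z - z)"
      unfolding y_def by (rule generator_graph_orbit_integral[OF P]) simp
    then have "generator_graph P y x"
      using z by (simp add: algebra_simps)
    from generator_graph_rescale[OF this, of 1] have "generator_graph T y (x + y)"
      by (simp add: P_def exp_minus)
    then show ?thesis ..
  qed
  define H where "H x = (SOME y. generator_graph T y (x + y))" for x
  have H: "generator_graph T (H x) (x + H x)" for x
    unfolding H_def using ex by (rule someI_ex)
  have unique: "H x = y" if "generator_graph T y (x + y)" for x y
  proof -
    have "generator_graph T (H x - y) (H x - y)"
      using generator_graph_diff[OF T H[of x] that] by (simp only: add_diff_cancel_left)
    from generator_numerical_range[OF le this]
    have "(1 - \<omega>) * (norm (H x - y))\<^sup>2 \<le> 0"
      by (simp add: power2_norm_eq_inner algebra_simps)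
    then show ?thesis
      using \<omega> by (simp add: mult_le_0_iff)
  qed
  have "H (x + y) = H x + H y" for x y
    using generator_graph_add[OF T H[of x] H[of y]] by (intro unique) (simp add: algebra_simps)
  moreover have "H (c *\<^sub>C x) = c *\<^sub>C H x" for c x
    using generator_graph_scaleC[OF T H[of x]] by (intro unique) (simp add: scaleC_add_right)
  ultimately show thesis
    using that[OF H] unique by simp
qed

section \<open>Uniqueness for dissipative evolution equations\<close>

text \<open>
  The mean value theorem does not apply to derivatives from the right.  Instead, tilt \<open>f\<close> by a small
  slope \<open>e\<close> so that it strictly decreases to the right of every point; then the last
  point of \<open>[0, b]\<close> where the tilted function is at most its initial value must be \<open>b\<close>.
\<close>

lemma antimono_of_right_derivative_nonpos:
  fixes f :: "real \<Rightarrow> real"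
  assumes cont: "continuous_on {0..} f" and "0 \<le> b"
    and deriv: "\<And>t. 0 \<le> t \<Longrightarrow> \<exists>w\<le>0. ((\<lambda>h. (f (t + h) - f t) / h) \<longlongrightarrow> w) (at_right 0)"
  shows "f b \<le> f 0"
proof (rule field_le_epsilon)
  fix d :: real assume "0 < d"
  define e where "e = d / (b + 1)"
  have e: "0 < e" "e * b \<le> d"
    using \<open>0 < d\<close> \<open>0 \<le> b\<close> by (simp_all add: e_def field_simps)
  define C where "C = {t \<in> {0..b}. f t - e * t \<le> f 0}"
  have "closed C"
    unfolding C_def
    by (intro continuous_on_closed_Collect_le continuous_intros continuous_on_subset[OF cont]) auto
  then have "compact C"
    by (rule compact_Int_closed[OF compact_Icc, of C 0 b, THEN back_subst[of compact]])
      (auto simp: C_def)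
  moreover have "C \<noteq> {}"
    using \<open>0 \<le> b\<close> by (auto simp: C_def)
  ultimately obtain s where "s \<in> C" and max: "\<And>t. t \<in> C \<Longrightarrow> t \<le> s"
    by (meson compact_attains_sup)
  then have s: "0 \<le> s" "s \<le> b" "f s - e * s \<le> f 0"
    by (auto simp: C_def)
  have "s = b"
  proof (rule ccontr)
    assume "s \<noteq> b"
    then have "s < b"
      using s by simp
    obtain w where "w \<le> 0" and lim: "((\<lambda>h. (f (s + h) - f s) / h) \<longlongrightarrow> w) (at_right 0)"
      using deriv[OF s(1)] by blast
    then have "\<forall>\<^sub>F h in at_right 0. (f (s + h) - f s) / h < e"
      using e(1) by (intro order_tendstoD(2)[OF lim]) simp
    moreover have "\<forall>\<^sub>F h in at_right 0. h < b - s"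
      using \<open>s < b\<close> by (intro eventually_at_rightI[of 0 "b - s"]) auto
    ultimately have "\<forall>\<^sub>F h in at_right 0. s + h \<in> C \<and> s < s + h"
      using eventually_at_right_less [of "0::real"]
    proof eventually_elim
      case (elim h)
      then show ?case
        using s by (simp add: C_def field_simps)
    qed
    then obtain h where "s + h \<in> C" "s < s + h"
      by (metis (no_types, lifting) eventually_happens' trivial_limit_at_right_real)
    then show False
      using max by fastforce
  qed
  then show "f b \<le> f 0 + d"
    using s e by simp
qed

lemma dissipative_orbit_norm_antimono:
  fixes v :: "real \<Rightarrow> 'a::real_inner"
  assumes cont: "continuous_on {0..} v" and "0 \<le> b"
    and deriv: "\<And>t. 0 \<le> t \<Longrightarrow>
      \<exists>w. inner w (v t) \<le> 0 \<and> ((\<lambda>h. (v (t + h) - v t) /\<^sub>R h) \<longlongrightarrow> w) (at_right 0)"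
  shows "norm (v b) \<le> norm (v 0)"
proof -
  have "inner (v b) (v b) \<le> inner (v 0) (v 0)"
  proof (rule antimono_of_right_derivative_nonpos[OF _ \<open>0 \<le> b\<close>])
    show "continuous_on {0..} (\<lambda>t. inner (v t) (v t))"
      by (intro continuous_intros cont)
    fix t :: real assume t: "0 \<le> t"
    from deriv[OF t] obtain w where w: "inner w (v t) \<le> 0"
      and lim: "((\<lambda>h. (v (t + h) - v t) /\<^sub>R h) \<longlongrightarrow> w) (at_right 0)" by blast
    have "((\<lambda>h. h *\<^sub>R ((v (t + h) - v t) /\<^sub>R h) + v t) \<longlongrightarrow> 0 *\<^sub>R w + v t) (at_right 0)"
      by (intro tendsto_intros lim)
    moreover have "\<forall>\<^sub>F h in at_right 0. h *\<^sub>R ((v (t + h) - v t) /\<^sub>R h) + v t = v (t + h)"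
      using eventually_at_right_less [of "0::real"] by eventually_elim simp
    ultimately have "((\<lambda>h. v (t + h)) \<longlongrightarrow> 0 *\<^sub>R w + v t) (at_right 0)"
      by (rule Lim_transform_eventually)
    then have "((\<lambda>h. inner ((v (t + h) - v t) /\<^sub>R h) (v (t + h) + v t)) \<longlongrightarrow> inner w (v t + v t))
        (at_right 0)"
      by (intro tendsto_intros lim) simp
    moreover have "inner ((v (t + h) - v t) /\<^sub>R h) (v (t + h) + v t)
        = (inner (v (t + h)) (v (t + h)) - inner (v t) (v t)) / h" for h
      by (simp add: inner_diff_left inner_add_right inner_commute[of "v t" "v (t + h)"] divide_inverse
          mult.commute flip: distrib_left)
    ultimately show "\<exists>w\<le>0. ((\<lambda>h. (inner (v (t + h)) (v (t + h)) - inner (v t) (v t)) / h) \<longlongrightarrow> w)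
        (at_right 0)"
      using w by (intro exI[of _ "inner w (v t + v t)"]) (simp add: inner_add_right)
  qed
  then show ?thesis
    by (simp add: norm_eq_sqrt_inner)
qed

text \<open>
  For \<open>x\<close> in the domain, the difference \<open>v\<close> of the two sides solves the evolution equation of
  \<open>U\<close> and starts at 0, and the norm of such a solution cannot grow.
\<close>

lemma semigroups_intertwine:
  fixes S :: "real \<Rightarrow> 'a::chilbert_space \<Rightarrow> 'a" and U :: "real \<Rightarrow> 'b::complex_inner \<Rightarrow> 'b"
  assumes S: "C0_semigroup S" and U: "C0_semigroup U" and J: "bounded_linear J"
    and dissipative: "\<And>x y. generator_graph U x y \<Longrightarrow> inner y x \<le> 0"
    and generators: "\<And>x y. generator_graph S x y \<Longrightarrow> generator_graph U (J x) (J y)"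
    and t: "0 \<le> t"
  shows "J (S t x) = U t (J x)"
proof -
  interpret J: bounded_linear J by (rule J)
  interpret St: bounded_linear "S t" using C0_semigroupD(3)[OF S t] .
  interpret Ut: bounded_linear "U t" using C0_semigroupD(3)[OF U t] .
  have "J (S t x) = U t (J x)" if "generator_graph S x y" for x y
  proof -
    define v where "v s = J (S s x) - U s (J x)" for s
    have "norm (v t) \<le> norm (v 0)"
    proof (rule dissipative_orbit_norm_antimono[OF _ t])
      show "continuous_on {0..} v"
        unfolding v_def
        by (intro continuous_intros J.continuous_on C0_semigroupD(5) S U)
      fix s :: real assume s: "0 \<le> s"
      note oS = generator_graph_orbit[OF S that s]
      note oU = generator_graph_orbit[OF U generators[OF that] s]
      have "generator_graph U (v s) (J (S s y) - U s (J y))"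
        unfolding v_def by (rule generator_graph_diff[OF U generators[OF oS(1)] oU(1)])
      then have "inner (J (S s y) - U s (J y)) (v s) \<le> 0"
        by (rule dissipative)
      moreover have "((\<lambda>h. J ((S (s + h) x - S s x) /\<^sub>R h) - (U (s + h) (J x) - U s (J x)) /\<^sub>R h)
          \<longlongrightarrow> J (S s y) - U s (J y)) (at_right 0)"
        by (intro tendsto_diff J.tendsto oS(2) oU(2))
      moreover have "J ((S (s + h) x - S s x) /\<^sub>R h) - (U (s + h) (J x) - U s (J x)) /\<^sub>R h
          = (v (s + h) - v s) /\<^sub>R h" for h
        by (simp add: v_def J.diff J.scaleR algebra_simps)
      ultimately show "\<exists>w. inner w (v s) \<le> 0 \<and>
          ((\<lambda>h. (v (s + h) - v s) /\<^sub>R h) \<longlongrightarrow> w) (at_right 0)"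
        by auto
    qed
    then show ?thesis
      by (simp add: v_def C0_semigroupD(1)[OF S] C0_semigroupD(1)[OF U])
  qed
  then have "{x. \<exists>y. generator_graph S x y} \<subseteq> {x. J (S t x) = U t (J x)}"
    by blast
  moreover have "closed {x. J (S t x) = U t (J x)}"
    by (intro closed_Collect_eq J.continuous_on St.continuous_on Ut.continuous_on continuous_on_id)
  ultimately show ?thesis
    using closure_minimal generator_domain_dense[OF S] by blast
qed

section \<open>Step functions on the half line\<close>

text \<open>
  The half line is divided into the cells \<open>[k + 1 - 1 / (n + 1), k + 1 - 1 / (n + 2))\<close>, indexed by
  pairs \<open>(k, n)\<close>.  Translation by 1 changes only \<open>k\<close>, and there are infinitely many values of
  \<open>n\<close>: this exhibits the backward shift as a shift of infinite multiplicity.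
\<close>

definition cell :: "real \<Rightarrow> nat \<times> nat" where
  "cell t = (nat \<lfloor>t\<rfloor>, nat \<lfloor>1 / (1 - frac t)\<rfloor> - 1)"

lemma cell_eq_iff:
  assumes "0 \<le> t"
  shows "cell t = (k, n) \<longleftrightarrow> real k + 1 - 1 / (real n + 1) \<le> t \<and> t < real k + 1 - 1 / (real n + 2)"
proof -
  define s where "s = frac t"
  have s: "0 \<le> s" "s < 1" "t = of_int \<lfloor>t\<rfloor> + s"
    using frac_lt_1[of t] by (simp_all add: s_def) (simp add: frac_def)
  have "1 \<le> \<lfloor>1 / (1 - s)\<rfloor>"
    using s by (simp add: field_simps)
  then have "nat \<lfloor>1 / (1 - s)\<rfloor> - 1 = n \<longleftrightarrow> \<lfloor>1 / (1 - s)\<rfloor> = int n + 1"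
    by linarith
  also have "\<dots> \<longleftrightarrow> real n + 1 \<le> 1 / (1 - s) \<and> 1 / (1 - s) < real n + 2"
    by (simp add: floor_eq_iff add.commute)
  also have "\<dots> \<longleftrightarrow> 1 - 1 / (real n + 1) \<le> s \<and> s < 1 - 1 / (real n + 2)"
    using s by (simp add: field_simps)
  finally have snd: "nat \<lfloor>1 / (1 - s)\<rfloor> - 1 = n \<longleftrightarrow>
      1 - 1 / (real n + 1) \<le> s \<and> s < 1 - 1 / (real n + 2)" .
  have fst: "nat \<lfloor>t\<rfloor> = k \<longleftrightarrow> \<lfloor>t\<rfloor> = int k"
    using assms by auto
  have frac: "0 \<le> 1 - 1 / (real n + 1)" "1 - 1 / (real n + 2) \<le> 1"
    by simp_all
  show ?thesis
  proof
    assume "cell t = (k, n)"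
    then have "\<lfloor>t\<rfloor> = int k" "1 - 1 / (real n + 1) \<le> s \<and> s < 1 - 1 / (real n + 2)"
      using fst snd by (auto simp: cell_def s_def)
    then show "real k + 1 - 1 / (real n + 1) \<le> t \<and> t < real k + 1 - 1 / (real n + 2)"
      using s(3) by simp
  next
    assume *: "real k + 1 - 1 / (real n + 1) \<le> t \<and> t < real k + 1 - 1 / (real n + 2)"
    then have "\<lfloor>t\<rfloor> = int k"
      using frac unfolding floor_eq_iff of_int_of_nat_eq by linarith
    moreover from this have "1 - 1 / (real n + 1) \<le> s \<and> s < 1 - 1 / (real n + 2)"
      using s(3) * by simp
    ultimately show "cell t = (k, n)"
      using fst snd by (simp add: cell_def s_def)
  qed
qed

lemma cell_add_1:
  assumes "0 \<le> t"
  shows "cell (t + 1) = (Suc (fst (cell t)), snd (cell t))"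
  using assms by (simp add: cell_def frac_1_eq nat_add_distrib)

lemma cell_vimage:
  "cell -` {(k, n)} \<inter> space half_line
    = {0<..} \<inter> {real k + 1 - 1 / (real n + 1)..<real k + 1 - 1 / (real n + 2)}"
  using cell_eq_iff by auto

lemma measurable_cell: "cell \<in> half_line \<rightarrow>\<^sub>M count_space UNIV"
proof (subst measurable_count_space_eq2_countable, safe)
  show "cell -` {(k, n)} \<inter> space half_line \<in> sets half_line" for k n
    unfolding cell_vimage by (simp add: sets_restrict_space_iff)
qed auto

lemma emeasure_cell:
  "emeasure half_line (cell -` {(k, n)} \<inter> space half_line)
    = ennreal (1 / ((real n + 1) * (real n + 2)))"
proof -
  define a b where "a = real k + 1 - 1 / (real n + 1)" and "b = real k + 1 - 1 / (real n + 2)"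
  have ab: "0 \<le> a" "a \<le> b" "b - a = 1 / ((real n + 1) * (real n + 2))"
    by (simp_all add: a_def b_def field_simps)
  have "emeasure half_line ({0<..} \<inter> {a..<b}) = emeasure lebesgue ({0<..} \<inter> {a..<b})"
    by (rule emeasure_restrict_space) auto
  also have "\<dots> = ennreal (b - a)"
  proof -
    have "{0<..} \<inter> {a..<b} = (if a = 0 then {a<..<b} else {a..<b})"
      using ab(1) by auto
    then show ?thesis
      using ab(2) by simp
  qed
  finally show ?thesis
    by (simp only: cell_vimage flip: a_def b_def ab(3))
qed

text \<open>The factor is the inverse of the square root of the length of the cell, so that \<open>c\<close> lists the
  coordinates of the step function with respect to an orthonormal family.\<close>

definition step_function :: "(nat \<times> nat \<Rightarrow> complex) \<Rightarrow> real \<Rightarrow> complex" where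
  "step_function c t = (case cell t of (k, n) \<Rightarrow>
     complex_of_real (sqrt ((real n + 1) * (real n + 2))) * c (k, n))"

lemma measurable_step_function: "step_function c \<in> borel_measurable half_line"
  unfolding step_function_def
  by (rule measurable_compose[OF measurable_cell]) simp

lemma nn_integral_step_function:
  "(\<integral>\<^sup>+t. ennreal ((cmod (step_function c t))\<^sup>2) \<partial>half_line)
    = (\<integral>\<^sup>+p. ennreal ((cmod (c p))\<^sup>2) \<partial>count_space UNIV)"
proof -
  define g where "g = (\<lambda>(k, n). ennreal ((real n + 1) * (real n + 2) * (cmod (c (k, n)))\<^sup>2))"
  have on_cell: "(\<integral>\<^sup>+t. g p * indicator (cell -` {p}) t \<partial>half_line) = ennreal ((cmod (c p))\<^sup>2)" for p
  proof (cases p)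
    case (Pair k n)
    have "(\<integral>\<^sup>+t. g p * indicator (cell -` {p}) t \<partial>half_line)
        = (\<integral>\<^sup>+t. g p * indicator (cell -` {p} \<inter> space half_line) t \<partial>half_line)"
      by (intro nn_integral_cong) (auto simp: indicator_def)
    also have "\<dots> = g p * emeasure half_line (cell -` {p} \<inter> space half_line)"
      by (intro nn_integral_cmult_indicator measurable_sets[OF measurable_cell]) simp
    also have "\<dots> = ennreal ((cmod (c p))\<^sup>2)"
      unfolding Pair emeasure_cell g_def by (simp flip: ennreal_mult')
    finally show ?thesis .
  qed
  have "ennreal ((cmod (step_function c t))\<^sup>2) = g (cell t)" for t
    by (simp add: step_function_def g_def norm_mult power_mult_distrib split: prod.split)
  also have "g (cell t) = (\<integral>\<^sup>+p. g p * indicator {cell t} p \<partial>count_space UNIV)" for t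
    by (subst nn_integral_count_space'[where A = "{cell t}"]) (auto simp: indicator_def)
  also have "\<dots> t = (\<integral>\<^sup>+p. g p * indicator (cell -` {p}) t \<partial>count_space UNIV)" for t
    by (intro nn_integral_cong) (auto simp: indicator_def)
  finally have "(\<integral>\<^sup>+t. ennreal ((cmod (step_function c t))\<^sup>2) \<partial>half_line)
      = (\<integral>\<^sup>+t. (\<integral>\<^sup>+p. g p * indicator (cell -` {p}) t \<partial>count_space UNIV) \<partial>half_line)"
    by (intro nn_integral_cong) simp
  also have "\<dots> = (\<integral>\<^sup>+p. (\<integral>\<^sup>+t. g p * indicator (cell -` {p}) t \<partial>half_line) \<partial>count_space UNIV)"
  proof (rule nn_integral_count_space_nn_integral)
    show "(\<lambda>t. g p * indicator (cell -` {p}) t) \<in> borel_measurable half_line" for p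
    proof -
      have "(\<lambda>t. g p * indicator {p} (cell t)) \<in> borel_measurable half_line"
        by (rule measurable_compose[OF measurable_cell]) simp
      then show ?thesis
        by (simp add: indicator_def)
    qed
  qed simp
  also have "\<dots> = (\<integral>\<^sup>+p. ennreal ((cmod (c p))\<^sup>2) \<partial>count_space UNIV)"
    by (simp only: on_cell)
  finally show ?thesis .
qed

lemma nn_integral_double_sum:
  fixes c :: "nat \<times> nat \<Rightarrow> complex"
  assumes "\<And>k. (\<lambda>n. (cmod (c (k, n)))\<^sup>2) sums a k" and "a sums s"
  shows "(\<integral>\<^sup>+p. ennreal ((cmod (c p))\<^sup>2) \<partial>count_space UNIV) = ennreal s"
proof -
  have nonneg: "0 \<le> a k" for k
    by (rule sums_le[OF _ sums_zero assms(1)[of k]]) simp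
  have "(\<integral>\<^sup>+p. ennreal ((cmod (c p))\<^sup>2) \<partial>count_space UNIV)
      = (\<Sum>k. \<Sum>n. ennreal ((cmod (c (k, n)))\<^sup>2))"
    by (simp add: nn_integral_fst_count_space[symmetric] nn_integral_count_space_nat)
  also have "\<dots> = (\<Sum>k. ennreal (a k))"
    by (intro suminf_cong suminf_ennreal_eq assms(1)) simp
  also have "\<dots> = ennreal s"
    using assms(2) nonneg by (intro suminf_ennreal_eq)
  finally show ?thesis .
qed

lemma square_integrable_step_function:
  assumes "(\<integral>\<^sup>+p. ennreal ((cmod (c p))\<^sup>2) \<partial>count_space UNIV) < \<infinity>"
  shows "square_integrable (step_function c)"
proof -
  note [measurable] = measurable_step_function[of c]
  show ?thesis
    unfolding square_integrable_def
    using assms by (auto intro!: integrableI_nonneg simp: nn_integral_step_function)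
qed

section \<open>Norms in \<open>L\<^sup>2(0,\<infinity>)\<close>\<close>

lemma L2_eq_refl: "L2_eq f f \<longleftrightarrow> square_integrable f"
  by (auto simp: L2_eq_def)

lemma norm_abs_L2:
  assumes "square_integrable f"
  shows "ennreal ((norm (abs_L2_half_line f))\<^sup>2) = (\<integral>\<^sup>+t. ennreal ((cmod (f t))\<^sup>2) \<partial>half_line)"
proof -
  have "(norm (abs_L2_half_line f))\<^sup>2 = Re (\<integral>t. f t * cnj (f t) \<partial>half_line)"
    using assms by (simp add: power2_norm_eq_inner inner_L2_half_line.abs_eq L2_eq_refl)
  also have "\<dots> = (\<integral>t. (cmod (f t))\<^sup>2 \<partial>half_line)"
    by (rule Re_integral_mult_cnj)
  also have "ennreal \<dots> = (\<integral>\<^sup>+t. ennreal ((cmod (f t))\<^sup>2) \<partial>half_line)"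
    using assms by (intro nn_integral_eq_integral[symmetric]) (auto simp: square_integrable_def)
  finally show ?thesis .
qed

lemma norm_backward_shift_le: "norm (backward_shift x) \<le> norm x"
proof (induction x rule: L2_half_line.abs_induct)
  case (1 f)
  then have f: "square_integrable f"
    by (simp add: L2_eq_refl)
  note sh = square_integrable_shift[OF f]
  define g where "g t = ennreal ((cmod (f t))\<^sup>2) * indicator {0<..} t" for t
  have half: "{0<..} \<inter> space lebesgue \<in> sets (lebesgue :: real measure)"
    by simp
  have g: "g \<in> borel_measurable lebesgue"
  proof -
    have "(\<lambda>t. ennreal ((cmod (f t))\<^sup>2)) \<in> borel_measurable half_line"
      using f by (auto simp: square_integrable_def)
    then show ?thesis
      unfolding g_def by (simp add: borel_measurable_restrict_space_iff_ennreal[OF half])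
  qed
  have "ennreal ((norm (backward_shift (abs_L2_half_line f)))\<^sup>2)
      = (\<integral>\<^sup>+t. ennreal ((cmod (f (t + 1)))\<^sup>2) \<partial>half_line)"
    using f by (simp add: backward_shift.abs_eq L2_eq_refl norm_abs_L2[OF sh])
  also have "\<dots> = (\<integral>\<^sup>+t. ennreal ((cmod (f (t + 1)))\<^sup>2) * indicator {0<..} t \<partial>lebesgue)"
    by (rule nn_integral_restrict_space[OF half])
  also have "\<dots> \<le> (\<integral>\<^sup>+t. g (1 + 1 * t) \<partial>lebesgue)"
    by (intro nn_integral_mono) (auto simp: g_def indicator_def add.commute)
  also have "\<dots> = (\<integral>\<^sup>+t. g t \<partial>lebesgue)"
    using nn_integral_real_affine_lebesgue[OF g, of 1 1] by simp
  also have "\<dots> = (\<integral>\<^sup>+t. ennreal ((cmod (f t))\<^sup>2) \<partial>half_line)"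
    unfolding g_def by (rule nn_integral_restrict_space[OF half, symmetric])
  also have "\<dots> = ennreal ((norm (abs_L2_half_line f))\<^sup>2)"
    by (rule norm_abs_L2[OF f, symmetric])
  finally show ?case
    by (simp add: power2_le_iff_abs_le)
qed

section \<open>The shift model of a stable contraction\<close>

text \<open>
  The coordinates of \<open>J x\<close> on the cells over \<open>[k, k + 1)\<close> are the values at \<open>(W ^^ k) x\<close> of the
  functionals that represent the defect form \<open>q\<close>, so that the square of their norm is
  \<open>(norm ((W ^^ k) x))\<^sup>2 - (norm ((W ^^ Suc k) x))\<^sup>2\<close>.  Stability makes the sum of these over \<open>k\<close> equal
  to \<open>(norm x)\<^sup>2\<close>.
\<close>

lemma backward_shift_model:
  fixes W :: "'a::complex_inner \<Rightarrow> 'a"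
  assumes sep: "separable_space (euclidean :: 'a topology)"
    and add: "\<And>x y. W (x + y) = W x + W y" and scale: "\<And>c x. W (c *\<^sub>C x) = c *\<^sub>C W x"
    and contraction: "\<And>x. norm (W x) \<le> norm x"
    and stable: "\<And>x. (\<lambda>n. (W ^^ n) x) \<longlonglongrightarrow> 0"
  obtains J :: "'a \<Rightarrow> L2_half_line"
  where "\<And>x y. J (x + y) = J x + J y" "\<And>c x. J (c *\<^sub>C x) = c *\<^sub>C J x"
    "\<And>x. norm (J x) = norm x" "\<And>x. J (W x) = backward_shift (J x)"
proof -
  define q where "q x y = cinner x y - cinner (W x) (W y)" for x y
  have q_self: "Re (q x x) = (norm x)\<^sup>2 - (norm (W x))\<^sup>2" for x
    by (simp add: q_def cinner_self)
  have "psd_form q"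
    unfolding psd_form_def
  proof (intro conjI allI)
    show "q x y = cnj (q y x)" for x y
      using cinner_commute[of x y] cinner_commute[of "W x" "W y"] by (simp add: q_def)
    show "0 \<le> Re (q x x)" for x
      using contraction[of x] by (simp add: q_self)
  qed (simp_all add: q_def add scale cinner_add_left cinner_scaleC_left algebra_simps)
  moreover have "Re (q x x) \<le> (norm x)\<^sup>2" for x
    by (simp add: q_self)
  ultimately obtain f :: "nat \<Rightarrow> 'a \<Rightarrow> complex" where f: "\<And>n x y. f n (x + y) = f n x + f n y"
      "\<And>n c x. f n (c *\<^sub>C x) = c * f n x" "\<And>y. (\<lambda>n. (cmod (f n y))\<^sup>2) sums Re (q y y)"
    using psd_form_sum_of_squares sep by blast
  define c where "c y = (\<lambda>(k, n). f n ((W ^^ k) y))" for y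
  define J where "J y = abs_L2_half_line (step_function (c y))" for y
  have pow: "(W ^^ k) (x + y) = (W ^^ k) x + (W ^^ k) y" "(W ^^ k) (a *\<^sub>C x) = a *\<^sub>C (W ^^ k) x"
    for k x y a
    by (induction k) (simp_all add: add scale)
  have nn: "(\<integral>\<^sup>+p. ennreal ((cmod (c y p))\<^sup>2) \<partial>count_space UNIV) = ennreal ((norm y)\<^sup>2)" for y
  proof (rule nn_integral_double_sum)
    show "(\<lambda>n. (cmod (c y (k, n)))\<^sup>2) sums ((norm ((W ^^ k) y))\<^sup>2 - (norm ((W ^^ Suc k) y))\<^sup>2)" for k
      using f(3)[of "(W ^^ k) y"] by (simp add: c_def q_self)
    have "(\<lambda>k. (norm ((W ^^ k) y))\<^sup>2) \<longlonglongrightarrow> (norm (0::'a))\<^sup>2"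
      by (intro tendsto_intros stable)
    from telescope_sums'[OF this]
    show "(\<lambda>k. (norm ((W ^^ k) y))\<^sup>2 - (norm ((W ^^ Suc k) y))\<^sup>2) sums (norm y)\<^sup>2"
      by simp
  qed
  have sq: "square_integrable (step_function (c y))" for y
    by (rule square_integrable_step_function) (simp add: nn)
  show thesis
  proof
    show "J (x + y) = J x + J y" for x y
    proof -
      have "step_function (c (x + y)) = (\<lambda>t. step_function (c x) t + step_function (c y) t)"
        by (simp add: step_function_def c_def fun_eq_iff pow f distrib_left split: prod.split)
      then show ?thesis
        by (simp add: J_def plus_L2_half_line.abs_eq L2_eq_refl sq)
    qed
    show "J (a *\<^sub>C x) = a *\<^sub>C J x" for a x
    proof -
      have "step_function (c (a *\<^sub>C x)) = (\<lambda>t. a * step_function (c x) t)"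
        by (simp add: step_function_def c_def fun_eq_iff pow f split: prod.split)
      then show ?thesis
        by (simp add: J_def scaleC_L2_half_line.abs_eq L2_eq_refl sq)
    qed
    show "norm (J x) = norm x" for x
    proof -
      have "ennreal ((norm (J x))\<^sup>2) = ennreal ((norm x)\<^sup>2)"
        unfolding J_def norm_abs_L2[OF sq] nn_integral_step_function nn ..
      then show ?thesis
        by (simp add: power2_eq_iff_nonneg)
    qed
    show "J (W x) = backward_shift (J x)" for x
    proof -
      have "c (W x) (k, n) = c x (Suc k, n)" for k n
        by (simp add: c_def funpow_swap1)
      then have "step_function (c (W x)) t = step_function (c x) (t + 1)" if "0 < t" for t
        using that by (simp add: step_function_def cell_add_1 split: prod.split)
      then have "AE t in half_line. step_function (c (W x)) t = step_function (c x) (t + 1)"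
        by (intro AE_I2) simp
      then have "L2_eq (step_function (c (W x))) (\<lambda>t. step_function (c x) (t + 1))"
        using sq square_integrable_shift[OF sq] by (simp add: L2_eq_def)
      then show ?thesis
        by (simp add: J_def backward_shift.abs_eq L2_eq_refl sq
            Quotient3_rel_abs[OF Quotient3_L2_half_line])
    qed
  qed
qed

section \<open>Cogenerators\<close>

text \<open>
  With \<open>G\<close> the inverse of \<open>A - 1\<close>, the cogenerator \<open>(A + 1) G\<close> is \<open>1 + 2 G\<close>; from here on it is
  used in this form.
\<close>

lemma cogenerator_resolvent:
  assumes "is_cogenerator U V"
  obtains G where "\<And>z. generator_graph U (G z) (z + G z)"
    "\<And>x y. generator_graph U x y \<Longrightarrow> G (y - x) = x" "\<And>z. V z = z + 2 *\<^sub>R G z"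
proof -
  define D where "D = generator_domain U"
  define B where "B x = generator U x - x" for x
  have one: "1 *\<^sub>C x = x" for x :: 'a
    using scaleR_eq_scaleC[of 1 x] by simp
  have bij: "bij_betw B D UNIV" and V: "V = (\<lambda>x. generator U x + x) \<circ> inv_into D B"
    using assms unfolding is_cogenerator_def spectrum_def B_def D_def by (simp_all add: one)
  define G where "G = inv_into D B"
  have G: "G z \<in> D" "B (G z) = z" for z
    unfolding G_def using bij inv_into_into[of z B D] f_inv_into_f[of z B D]
    by (simp_all add: bij_betw_def)
  show thesis
  proof
    show "generator_graph U (G z) (z + G z)" for z
      using G[of z] by (simp add: generator_graph_iff D_def B_def diff_eq_eq)
    show "G (y - x) = x" if "generator_graph U x y" for x y
      using that bij inv_into_f_f[of B D x]
      by (auto simp: generator_graph_iff bij_betw_def G_def D_def B_def)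
    show "V z = z + 2 *\<^sub>R G z" for z
      using G(2)[of z] by (simp add: V B_def scaleR_2 flip: G_def) (simp add: algebra_simps)
  qed
qed

text \<open>
  If \<open>w\<close> is the image of \<open>z\<close> under the inverse of \<open>A - 1\<close>, then \<open>z + w = A w\<close>: contractivity of the
  cogenerator is dissipativity of \<open>A\<close>.
\<close>

lemma norm_cayley:
  fixes z w :: "'a::real_inner"
  shows "(norm (z + 2 *\<^sub>R w))\<^sup>2 = (norm z)\<^sup>2 + 4 * inner (z + w) w"
  by (simp add: power2_norm_eq_inner inner_add_left inner_add_right inner_commute[of w z])

lemma dissipative_of_contractive_cogenerator:
  assumes "is_cogenerator U V" and "\<And>x. norm (V x) \<le> norm x" and "generator_graph U x y"
  shows "inner y x \<le> 0"
proof -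
  obtain G where G: "\<And>x y. generator_graph U x y \<Longrightarrow> G (y - x) = x" "\<And>z. V z = z + 2 *\<^sub>R G z"
    using cogenerator_resolvent[OF assms(1)] by metis
  have "V (y - x) = (y - x) + 2 *\<^sub>R x"
    using G assms(3) by simp
  then have "(norm (y - x + 2 *\<^sub>R x))\<^sup>2 \<le> (norm (y - x))\<^sup>2"
    using assms(2)[of "y - x"] by simp
  then show ?thesis
    unfolding norm_cayley by simp
qed

text \<open>
  By \<open>norm_cayley\<close>, each step of an orbit of \<open>W\<close> reduces the squared norm by at least
  \<open>- 4 \<omega> (norm (H z))\<^sup>2\<close>, where \<open>z\<close> is the current point.  As the norm stays nonnegative,
  \<open>H ((W ^^ n) z) = (W ^^ n) (H z)\<close> tends to 0; since the powers of \<open>W\<close> are contractions, this extends from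
  the range of \<open>H\<close> to its closure.
\<close>

lemma stable_cogenerator:
  fixes H :: "'a::real_inner \<Rightarrow> 'a"
  assumes "\<omega> < 0" and add: "\<And>x y. H (x + y) = H x + H y"
    and range: "\<And>z. inner (z + H z) (H z) \<le> \<omega> * (norm (H z))\<^sup>2"
    and dense: "closure (range H) = UNIV"
  defines "W \<equiv> \<lambda>z. z + 2 *\<^sub>R H z"
  shows "norm (W z) \<le> norm z" and "(\<lambda>n. (W ^^ n) z) \<longlonglongrightarrow> 0"
proof -
  have decay: "4 * - \<omega> * (norm (H z))\<^sup>2 \<le> (norm z)\<^sup>2 - (norm (W z))\<^sup>2" for z
    using range[of z] unfolding W_def norm_cayley by simp
  show contraction: "norm (W z) \<le> norm z" for z
  proof -
    have "0 \<le> 4 * - \<omega> * (norm (H z))\<^sup>2"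
      using assms(1) by (simp add: mult_nonpos_nonneg)
    then have "(norm (W z))\<^sup>2 \<le> (norm z)\<^sup>2"
      using decay[of z] by linarith
    then show ?thesis
      by simp
  qed
  have W_add: "W (x + y) = W x + W y" for x y
    by (simp add: W_def add algebra_simps)
  have pow_add: "(W ^^ n) (x + y) = (W ^^ n) x + (W ^^ n) y" for n x y
    by (induction n) (simp_all add: W_add)
  have pow_contraction: "norm ((W ^^ n) x) \<le> norm x" for n x
    by (induction n) (auto intro: order_trans[OF contraction])
  have "H (W z) = W (H z)" for z
    by (simp add: W_def add scaleR_2)
  then have commute: "H ((W ^^ n) z) = (W ^^ n) (H z)" for n z
    by (induction n) simp_all
  have on_range: "(\<lambda>n. (W ^^ n) (H z)) \<longlonglongrightarrow> 0" for z
  proof -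
    have "(\<Sum>n<m. 4 * - \<omega> * (norm (H ((W ^^ n) z)))\<^sup>2) \<le> (norm z)\<^sup>2 - (norm ((W ^^ m) z))\<^sup>2" for m
    proof (induction m)
      case (Suc m)
      then show ?case
        using decay[of "(W ^^ m) z"] by simp
    qed simp
    then have "(\<Sum>n<m. 4 * - \<omega> * (norm (H ((W ^^ n) z)))\<^sup>2) \<le> (norm z)\<^sup>2" for m
      by (rule order_trans) simp
    then have "summable (\<lambda>n. 4 * - \<omega> * (norm (H ((W ^^ n) z)))\<^sup>2)"
      using assms(1) by (intro summableI_nonneg_bounded) (auto simp: mult_nonpos_nonneg)
    then have "(\<lambda>n. (norm (H ((W ^^ n) z)))\<^sup>2) \<longlonglongrightarrow> 0"
      using assms(1)
      by (intro summable_LIMSEQ_zero) (rule summable_mult_D[where c = "4 * - \<omega>"], auto)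
    from tendsto_real_sqrt[OF this] show ?thesis
      by (simp add: commute tendsto_norm_zero_iff)
  qed
  show "(\<lambda>n. (W ^^ n) z) \<longlonglongrightarrow> 0"
  proof (rule LIMSEQ_I)
    fix e :: real assume "0 < e"
    have "z \<in> closure (range H)"
      using dense by simp
    then obtain u where u: "dist (H u) z < e / 2"
      unfolding closure_approachable using \<open>0 < e\<close> by (metis half_gt_zero rangeE)
    obtain m where m: "norm ((W ^^ n) (H u)) < e / 2" if "m \<le> n" for n
      using LIMSEQ_D[OF on_range[of u], of "e / 2"] \<open>0 < e\<close> by auto
    have "norm ((W ^^ n) z) < e" if "m \<le> n" for n
    proof -
      have "norm ((W ^^ n) z) = norm ((W ^^ n) (z - H u) + (W ^^ n) (H u))"
        using pow_add[of n "z - H u" "H u"] by simp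
      also have "\<dots> \<le> norm (z - H u) + norm ((W ^^ n) (H u))"
        by (intro norm_triangle_le add_right_mono pow_contraction)
      also have "\<dots> < e"
        using u m[OF that] by (simp add: dist_norm norm_minus_commute)
      finally show ?thesis .
    qed
    then show "\<exists>m. \<forall>n\<ge>m. norm ((W ^^ n) z - 0) < e"
      by auto
  qed
qed

lemma exponentially_stable_semigroup_model:
  fixes U :: "real \<Rightarrow> L2_half_line \<Rightarrow> L2_half_line" and S :: "real \<Rightarrow> 'k::chilbert_space \<Rightarrow> 'k"
  assumes U: "C0_semigroup U" and cogenerator: "is_cogenerator U backward_shift"
    and sep: "separable_space (euclidean :: 'k topology)"
    and S: "C0_semigroup S" and "\<omega> < 0"
    and le: "\<And>t x. 0 \<le> t \<Longrightarrow> norm (S t x) \<le> exp (\<omega> * t) * norm x"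
  obtains J :: "'k \<Rightarrow> L2_half_line"
  where "\<And>x y. J (x + y) = J x + J y" "\<And>c x. J (c *\<^sub>C x) = c *\<^sub>C J x"
    "\<And>x. norm (J x) = norm x" "\<And>t x. 0 \<le> t \<Longrightarrow> J (S t x) = U t (J x)"
proof -
  have "\<omega> < 1"
    using \<open>\<omega> < 0\<close> by simp
  from resolvent_at_1[OF S this le] obtain H where
    H: "\<And>z. generator_graph S (H z) (z + H z)" "\<And>x y. generator_graph S x y \<Longrightarrow> H (y - x) = x"
    and H_add: "\<And>x y. H (x + y) = H x + H y" and H_scale: "\<And>c x. H (c *\<^sub>C x) = c *\<^sub>C H x"
    by blast
  obtain G where
    G: "\<And>z. generator_graph U (G z) (z + G z)" "\<And>z. backward_shift z = z + 2 *\<^sub>R G z"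
    using cogenerator_resolvent[OF cogenerator] by metis
  define W where "W z = z + 2 *\<^sub>R H z" for z
  have "{x. \<exists>y. generator_graph S x y} \<subseteq> range H"
    using H(2) by (auto intro: range_eqI[OF sym])
  from closure_mono[OF this] have "closure (range H) = UNIV"
    unfolding generator_domain_dense[OF S] by (rule top.extremum_uniqueI)
  note stable = stable_cogenerator[OF \<open>\<omega> < 0\<close> H_add generator_numerical_range[OF le H(1)] this,
      folded W_def]
  have "W (x + y) = W x + W y" "W (c *\<^sub>C x) = c *\<^sub>C W x" for x y c
    by (simp_all add: W_def H_add H_scale scaleC_add_right scaleR_add_right scaleR_eq_scaleC
        scaleC_scaleC mult.commute)
  from backward_shift_model[OF sep this stable] obtain J :: "'k \<Rightarrow> L2_half_line" where
    J: "\<And>x y. J (x + y) = J x + J y" "\<And>c x. J (c *\<^sub>C x) = c *\<^sub>C J x" "\<And>x. norm (J x) = norm x"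
    and J_W: "\<And>x. J (W x) = backward_shift (J x)"
    by blast
  have J_linear: "bounded_linear J"
    using J by (rule bounded_linear_isometry)
  (* J intertwines the cogenerators 1 + 2 H and 1 + 2 G, hence the resolvents *)
  have J_H: "J (H z) = G (J z)" for z
  proof -
    have "J z + 2 *\<^sub>R J (H z) = J z + 2 *\<^sub>R G (J z)"
      using J_W[of z] by (simp add: W_def G(2) J(1) linear_scale[OF bounded_linear.linear[OF J_linear]])
    then show ?thesis
      by simp
  qed
  have "J (S t x) = U t (J x)" if "0 \<le> t" for t x
  proof (rule semigroups_intertwine[OF S U J_linear _ _ that])
    show "inner y x \<le> 0" if "generator_graph U x y" for x y
      using cogenerator norm_backward_shift_le that by (rule dissipative_of_contractive_cogenerator)
    show "generator_graph U (J x) (J y)" if "generator_graph S x y" for x y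
    proof -
      have x: "H (y - x) = x"
        using that by (rule H(2))
      have "J (y - x) + J x = J y"
        using J(1)[of "y - x" x] by simp
      then show ?thesis
        using G(1)[of "J (y - x)"] J_H[of "y - x"] x by simp
    qed
  qed
  with J show thesis
    by (rule that)
qed

section \<open>Quasicontractive semigroups\<close>

theorem corollary3p6:
  fixes U :: "real \<Rightarrow> L2_half_line \<Rightarrow> L2_half_line"
    and T :: "real \<Rightarrow> 'k::chilbert_space \<Rightarrow> 'k"
  assumes "C0_semigroup U"
    and "is_cogenerator U backward_shift"
    and "separable_space (euclidean :: 'k topology)"
    and "\<not> (\<exists>B :: 'k set. finite B \<and> cspan B = UNIV)"
    and "C0_semigroup T"
    and "quasicontractive T"
  shows "\<exists>(M :: L2_half_line set) (l :: real) (R :: L2_half_line \<Rightarrow> 'k).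
           csubspace M \<and> closed M \<and> (\<forall>t\<ge>0. U t ` M \<subseteq> M) \<and>
           bounded_clinear_iso_on M R \<and>
           (\<forall>t\<ge>0. \<forall>y. T t y = exp (l * t) *\<^sub>R R (U t (inv_into M R y)))"
proof -
  obtain \<omega> where \<omega>: "\<And>t. 0 \<le> t \<Longrightarrow> onorm (T t) \<le> exp (\<omega> * t)"
    using assms(6) by (auto simp: quasicontractive_def)
  (* any l > \<omega> makes the rescaled semigroup decay exponentially; this one gives the rate 1 *)
  define l where "l = \<omega> + 1"
  define S where "S = (\<lambda>t x. exp (- l * t) *\<^sub>R T t x)"
  have S: "C0_semigroup S"
    unfolding S_def by (rule C0_semigroup_rescale[OF assms(5)])
  have S_le: "norm (S t x) \<le> exp ((-1) * t) * norm x" if "0 \<le> t" for t x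
  proof -
    have "norm (T t x) \<le> onorm (T t) * norm x"
      by (rule onorm[OF C0_semigroupD(3)[OF assms(5) that]])
    also have "\<dots> \<le> exp (\<omega> * t) * norm x"
      by (rule mult_right_mono[OF \<omega>[OF that]]) simp
    finally have "exp (- l * t) * norm (T t x) \<le> exp (- l * t) * (exp (\<omega> * t) * norm x)"
      by (rule mult_left_mono) simp
    also have "\<dots> = exp ((-1) * t) * norm x"
      by (simp add: l_def algebra_simps flip: exp_add mult.assoc)
    finally show ?thesis
      by (simp add: S_def)
  qed
  have "(- 1 :: real) < 0"
    by simp
  from exponentially_stable_semigroup_model[OF assms(1,2,3) S this S_le]
  obtain J :: "'k \<Rightarrow> L2_half_line" where
    J_add: "\<And>x y. J (x + y) = J x + J y" and J_scale: "\<And>c x. J (c *\<^sub>C x) = c *\<^sub>C J x"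
    and J_norm: "\<And>x. norm (J x) = norm x" and J_S: "\<And>t x. 0 \<le> t \<Longrightarrow> J (S t x) = U t (J x)"
    by metis
  interpret J: bounded_linear J
    using J_add J_scale J_norm by (rule bounded_linear_isometry)
  have inj: "inj J"
    by (rule injI) (metis J.diff J_norm eq_iff_diff_eq_0 norm_eq_zero)
  define M where "M = range J"
  define R where "R = inv J"
  have R_J: "R (J x) = x" for x
    unfolding R_def by (rule inv_f_f[OF inj])
  have bij: "bij_betw R M UNIV"
    unfolding R_def M_def by (rule bij_betw_inv_into) (simp add: inj bij_betw_def)
  have inv_R: "inv_into M R y = J y" for y
    using inv_into_f_f[of R M "J y"] bij by (simp add: bij_betw_def R_J M_def)
  have "csubspace M"
    unfolding complex_vector.subspace_def
  proof (intro conjI ballI allI)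
    show "0 \<in> M"
      using J.zero unfolding M_def by (metis rangeI)
    show "x + y \<in> M" if "x \<in> M" "y \<in> M" for x y
      using that by (auto simp: M_def simp flip: J_add)
    show "c *\<^sub>C x \<in> M" if "x \<in> M" for c x
      using that by (auto simp: M_def simp flip: J_scale)
  qed
  moreover have "closed M"
  proof -
    have "complete (J ` UNIV)"
      by (rule complete_isometric_image[OF zero_less_one _ J.bounded_linear_axioms])
        (simp_all add: J_norm complete_UNIV subspace_UNIV)
    then show ?thesis
      unfolding M_def by (rule complete_imp_closed)
  qed
  moreover have "\<forall>t\<ge>0. U t ` M \<subseteq> M"
    by (auto simp: M_def simp flip: J_S)
  moreover have "bounded_clinear_iso_on M R"
    unfolding bounded_clinear_iso_on_def
  proof (intro conjI)
    show "\<forall>x\<in>M. \<forall>y\<in>M. R (x + y) = R x + R y" "\<forall>c. \<forall>x\<in>M. R (c *\<^sub>C x) = c *\<^sub>C R x"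
      by (auto simp: M_def R_J simp flip: J_add J_scale)
    show "\<exists>K. \<forall>x\<in>M. norm (R x) \<le> norm x * K"
      by (rule exI[of _ 1]) (auto simp: M_def R_J J_norm)
    show "\<exists>K. \<forall>y. norm (inv_into M R y) \<le> norm y * K"
      by (rule exI[of _ 1]) (simp add: inv_R J_norm)
  qed (rule bij)
  moreover have "T t y = exp (l * t) *\<^sub>R R (U t (inv_into M R y))" if "0 \<le> t" for t y
    using that by (simp add: inv_R R_J S_def flip: J_S) (simp flip: exp_add)
  ultimately show ?thesis
    by blast
qed

end
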